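(* Define integers $b_{19}(n)$ by $\sum_{n\ge 0} b_{19}(n)q^n = \prod_{i\ge 1}\frac{1-q^{19i}}{1-q^{i}}$. Then, coefficientwise modulo $2$, $$\sum_{n=0}^\infty b_{19}(10n+8)\,q^n \equiv q\sum_{n=0}^\infty b_{19}(2n)\,q^{5n} \pmod 2.$$ Consequently: (i) $b_{19}(50n+10k+8)\equiv 0 \pmod 2$ for all integers $n\ge 0$ and all integers $k\ge 0$ with $k\not\equiv 1\pmod 5$; (ii) for all integers $d\ge 1$ and $n\ge 0$, $b_{19}(2n)\equiv b_{19}\!\left(2\cdot 5^{2d} n + 18\cdot\frac{5^{2d}-1}{24}\right) \pmod 2$; (iii) for all integers $d\ge 1$, $n\ge 0$, and $k\ge 0$ with $k\not\equiv 1 \pmod 5$, $$b_{19}\!\left(2\cdot 5^{2d}(25n+5k+4) + 18\cdot\frac{5^{2d}-1}{24}\right)\equiv 0 \pmod 2.$$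
   Context: A congruence between power series modulo $2$ means all corresponding coefficients are congruent modulo $2$. *)

theory Defs
  imports "HOL-Analysis.Analysis" "HOL-Number_Theory.Cong"
begin

definition fps_cong :: "int fps \<Rightarrow> int fps \<Rightarrow> int \<Rightarrow> bool" where
  "fps_cong F G m \<longleftrightarrow> (\<forall>n. [fps_nth F n = fps_nth G n] (mod m))"

text \<open>
  Library products are indexed from 0, so index \<open>i\<close> below stands for the factor with
  index \<open>i + 1\<close>. The quotient is taken over the rationals because division of power series
  in the library needs an inverse on the coefficients.
\<close>

definition b_factor :: "nat \<Rightarrow> nat \<Rightarrow> rat fps" where
  "b_factor l i = (1 - fps_X ^ (l * Suc i)) / (1 - fps_X ^ Suc i)"

text \<open>
  The product converges in the metric (X-adic) topology of formal power series. Lemma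
  \<open>b_regular_has_prod\<close> shows that the integer sequence described here exists for \<open>l \<ge> 1\<close>.
\<close>

definition b_regular :: "nat \<Rightarrow> nat \<Rightarrow> int" where
  "b_regular l = (THE b. b_factor l has_prod Abs_fps (\<lambda>n. of_int (b n)))"

lemma inverse_one_minus_fps_X_power:
  assumes "k > 0"
  shows "inverse (1 - fps_X ^ k :: rat fps) = Abs_fps (\<lambda>n. if k dvd n then 1 else 0)"
proof -
  have "(1 - fps_X ^ k) * Abs_fps (\<lambda>n. if k dvd n then 1 else 0) = (1 :: rat fps)"
  proof (rule fps_ext)
    fix n
    show "fps_nth ((1 - fps_X ^ k) * Abs_fps (\<lambda>n. if k dvd n then 1 else 0)) n
        = fps_nth (1 :: rat fps) n"
      using assms by (cases "n < k") (auto simp: algebra_simps fps_X_power_mult_nth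
        dvd_minus_self dest: dvd_imp_le)
  qed
  then show ?thesis
    by (rule fps_inverse_unique)
qed

lemma b_factor_eq:
  "b_factor l i = (1 - fps_X ^ (l * Suc i)) * Abs_fps (\<lambda>n. if Suc i dvd n then 1 else 0)"
proof -
  have "fps_nth (1 - fps_X ^ Suc i :: rat fps) 0 \<noteq> 0"
    by simp
  then show ?thesis
    unfolding b_factor_def
    by (metis fps_divide_unit inverse_one_minus_fps_X_power zero_less_Suc)
qed

lemma b_factor_nth_Ints: "fps_nth (b_factor l i) n \<in> \<int>"
  unfolding b_factor_eq fps_mult_nth by (intro Ints_sum Ints_mult) (auto simp: fps_X_power_nth)

lemma b_factor_nth_small:
  assumes "l \<ge> 1" "n \<le> i"
  shows "fps_nth (b_factor l i) n = (if n = 0 then 1 else 0)"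
proof -
  have "Suc i \<le> l * Suc i"
    using mult_le_mono1[OF assms(1), of "Suc i"] by simp
  then have "n < l * Suc i"
    using assms(2) by linarith
  moreover have "Suc i dvd n \<longleftrightarrow> n = 0"
    using assms(2) by (auto dest: dvd_imp_le)
  ultimately show ?thesis
    unfolding b_factor_eq left_diff_distrib mult_1_left fps_sub_nth fps_X_power_mult_nth
    by simp
qed

lemma b_regular_has_prod:
  assumes "l \<ge> 1"
  shows "b_factor l has_prod Abs_fps (\<lambda>n. of_int (b_regular l n))"
proof -
  define P where "P n = (\<Prod>i\<le>n. b_factor l i)" for n
  have P_Ints: "fps_nth (P n) k \<in> \<int>" for n k
  proof (induction n arbitrary: k)
    case 0
    then show ?case by (simp add: P_def b_factor_nth_Ints)
  next
    case (Suc n)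
    have "P (Suc n) = P n * b_factor l (Suc n)"
      by (simp add: P_def)
    then show ?case
      by (auto simp: fps_mult_nth intro!: Ints_sum Ints_mult Suc.IH b_factor_nth_Ints)
  qed
  have step: "fps_nth (P (Suc n)) k = fps_nth (P n) k" if "k \<le> n" for n k
  proof -
    have "P (Suc n) = b_factor l (Suc n) * P n"
      by (simp add: P_def mult.commute)
    then have "fps_nth (P (Suc n)) k
        = (\<Sum>i=0..k. fps_nth (b_factor l (Suc n)) i * fps_nth (P n) (k - i))"
      by (simp add: fps_mult_nth)
    also have "\<dots> = (\<Sum>i=0..k. if i = 0 then fps_nth (P n) (k - i) else 0)"
      using that assms by (intro sum.cong) (auto simp: b_factor_nth_small)
    finally show ?thesis by simp
  qed
  have stable: "fps_nth (P n) k = fps_nth (P k) k" if "k \<le> n" for n k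
    using that by (induction n rule: dec_induct) (auto simp: step)
  define b where "b n = \<lfloor>fps_nth (P n) n\<rfloor>" for n
  have b: "of_int (b n) = fps_nth (P n) n" for n
    using P_Ints[of n n] by (auto simp: b_def elim!: Ints_cases)
  have "P \<longlonglongrightarrow> Abs_fps (\<lambda>n. of_int (b n))"
    unfolding tendsto_fps_iff
    by (auto simp: b eventually_sequentially intro!: exI stable)
  moreover have "fps_nth (P 0) 0 = 1"
    using b_factor_nth_small[OF assms, of 0 0] by (simp add: P_def)
  then have "Abs_fps (\<lambda>n. of_int (b n)) \<noteq> (0 :: rat fps)"
    by (auto simp: fps_eq_iff b intro!: exI[of _ 0])
  ultimately have ex: "b_factor l has_prod Abs_fps (\<lambda>n. of_int (b n))"
    by (simp add: has_prod_def raw_has_prod_def P_def[abs_def])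
  show ?thesis
    unfolding b_regular_def
  proof (rule theI[where P = "\<lambda>b. b_factor l has_prod Abs_fps (\<lambda>n. of_int (b n))", OF ex])
    fix c :: "nat \<Rightarrow> int"
    assume "b_factor l has_prod Abs_fps (\<lambda>n. of_int (c n))"
    from has_prod_unique2[OF this ex] show "c = b"
      by (auto simp: fps_eq_iff)
  qed
qed

end

theory Submission
  imports Defs "HOL-Number_Theory.Number_Theory" "HOL-Library.Z2" "HOL-Library.Disjoint_Sets"
    "HOL-Computational_Algebra.Formal_Laurent_Series"
begin

text \<open>
  Let \<open>\<theta>(q) = \<Sum> q^((a^2-1)/24)\<close> over the positive \<open>a\<close> coprime to 6. By the pentagonal number theorem
  \<open>\<theta> \<equiv> \<Prod>(1-q^i)\<close> modulo 2, so \<open>B \<theta>(q) \<equiv> \<theta>(q^19)\<close> for the generating function \<open>B\<close> of \<open>b_19\<close>. As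
  \<open>\<theta>(q)^2 \<equiv> \<theta>(q^2)\<close>, the series \<open>\<Sum> b_19(2n) q^n\<close> times \<open>\<theta>(q)\<close> is the even part of \<open>\<theta>(q) \<theta>(q^19)\<close>.
  The key is that, modulo 2, \<open>b_19(2n)\<close> counts the solutions of
  \<open>a^2 + 152 z^2 = 24n+9\<close> (\<open>a\<close> coprime to 6, \<open>z\<close> to 3), \<open>9x^2 = 24n+9\<close> and \<open>57y^2 = 24n+9\<close>.
  Since -152 is not a square modulo 5, such a solution at \<open>5n+4\<close> is 5 times a solution at \<open>(n-1)/5\<close>,
  which gives the congruence, and the other claims follow by iterating it.

  To verify the count, multiply by \<open>\<theta>(q)\<close>: the involution exchanging \<open>a\<close> with the summation variable
  of \<open>\<theta>\<close> leaves \<open>a^2 + 76 z^2 = N\<close> with \<open>N = 12k+5\<close>, and the claim becomes that the numbers of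
  positive solutions of \<open>a^2 + 9b^2 = 2N\<close>, \<open>a^2 + 19b^2 = 4N\<close> and \<open>a^2 + 57b^2 = 2N\<close> have an even sum.
  The primitive solutions correspond two to one to the square roots of -9, -19 and -57 modulo \<open>N\<close>,
  by Thue's lemma, and the total number of these square roots is divisible by 4: this is clear unless \<open>N\<close>
  is (up to a factor 19) a prime power, where it follows from the quadratic character of 3.
\<close>

section \<open>Square roots modulo n\<close>

text \<open>Points moved by \<open>h\<close> fall into pairs, so the sum of ones over them vanishes
  over \<open>bit\<close> and only fixed points affect the parity.\<close>

lemma even_card_involution:
  assumes "finite X" "\<And>x. x \<in> X \<Longrightarrow> h x \<in> X" "\<And>x. x \<in> X \<Longrightarrow> h (h x) = x"
  shows "even (card X) \<longleftrightarrow> even (card {x \<in> X. h x = x})"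
proof -
  let ?Y = "{x \<in> X. h x \<noteq> x}"
  have "(\<Sum>x\<in>?Y. 1 :: bit) = 0"
    by (rule sum_involution_eq_0[where h = h]) (use assms in auto)
  then have "of_nat (card ?Y) = (0 :: bit)"
    by simp
  then have "even (card ?Y)"
    by (metis even_of_nat even_zero)
  moreover have "card X = card {x \<in> X. h x = x} + card ?Y"
    using assms(1) by (subst card_Un_disjoint[symmetric]) (auto intro!: arg_cong[where f = card])
  ultimately show ?thesis
    by simp
qed

definition neg_roots :: "int \<Rightarrow> int \<Rightarrow> int set" where
  "neg_roots D n = {r. 0 \<le> r \<and> r < n \<and> n dvd r\<^sup>2 + D}"

lemma finite_neg_roots [simp]: "finite (neg_roots D n)"
  by (rule finite_subset[of _ "{0..<n}"]) (auto simp: neg_roots_def)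

lemma dvd_square_plus_cong:
  fixes n :: int
  assumes "[r = s] (mod n)"
  shows "n dvd r\<^sup>2 + D \<longleftrightarrow> n dvd s\<^sup>2 + D"
proof -
  have "[r\<^sup>2 + D = s\<^sup>2 + D] (mod n)"
    using assms by (intro cong_add cong_pow) auto
  then show ?thesis
    by (rule cong_dvd_iff)
qed

lemma neg_roots_mod: "n > 0 \<Longrightarrow> n dvd r\<^sup>2 + D \<Longrightarrow> r mod n \<in> neg_roots D n"
  by (auto simp: neg_roots_def dvd_square_plus_cong[of "r mod n" r n D])

text \<open>Chinese remainder theorem: reducing a root modulo \<open>u\<close> and modulo
  \<open>v\<close> is a bijection onto pairs of roots.\<close>

lemma card_neg_roots_mult:
  assumes "coprime u v" "u > 0" "v > 0"
  shows "card (neg_roots D (u * v)) = card (neg_roots D u) * card (neg_roots D v)"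
proof -
  let ?f = "\<lambda>r. (r mod u, r mod v)"
  have "bij_betw ?f (neg_roots D (u * v)) (neg_roots D u \<times> neg_roots D v)"
  proof (rule bij_betwI')
    fix r s assume r: "r \<in> neg_roots D (u * v)" and s: "s \<in> neg_roots D (u * v)"
    show "(?f r = ?f s) = (r = s)"
    proof
      assume "?f r = ?f s"
      then have "[r = s] (mod u)" "[r = s] (mod v)"
        by (auto simp: cong_def)
      then have "[r = s] (mod u * v)"
        using assms(1) by (simp add: coprime_cong_mult)
      then show "r = s"
        using r s by (auto simp: neg_roots_def intro: cong_less_imp_eq_int)
    qed simp
  next
    fix r assume "r \<in> neg_roots D (u * v)"
    then have "u * v dvd r\<^sup>2 + D"
      by (simp add: neg_roots_def)
    then have "u dvd r\<^sup>2 + D" "v dvd r\<^sup>2 + D"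
      by (auto dest: dvd_mult_left dvd_mult_right)
    then show "?f r \<in> neg_roots D u \<times> neg_roots D v"
      using assms by (auto intro: neg_roots_mod)
  next
    fix y assume y: "y \<in> neg_roots D u \<times> neg_roots D v"
    obtain a b where ab: "y = (a, b)" by force
    obtain x where x: "[x = a] (mod u)" "[x = b] (mod v)"
      using binary_chinese_remainder_int[OF assms(1)] by blast
    have "u dvd x\<^sup>2 + D" "v dvd x\<^sup>2 + D"
      using y x ab by (auto simp: neg_roots_def dvd_square_plus_cong)
    then have "u * v dvd x\<^sup>2 + D"
      using assms(1) by (simp add: divides_mult)
    then have "x mod (u * v) \<in> neg_roots D (u * v)"
      using assms by (intro neg_roots_mod) auto
    moreover have "?f (x mod (u * v)) = y"
      using x y ab by (auto simp: neg_roots_def cong_def mod_mod_cancel)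
    ultimately show "\<exists>r\<in>neg_roots D (u * v). y = ?f r"
      by blast
  qed
  then show ?thesis
    by (simp add: bij_betw_same_card card_cartesian_product)
qed

text \<open>The roots pair off as \<open>r\<close> and \<open>n - r\<close>. No root is its own
  partner because \<open>n\<close> is odd, and 0 is not a root because \<open>D\<close> is a unit
  modulo \<open>n > 1\<close>.\<close>

lemma even_card_neg_roots:
  assumes "coprime D n" "odd n" "n > 1"
  shows "even (card (neg_roots D n))"
proof -
  have nz: "0 \<notin> neg_roots D n"
    using assms coprime_common_divisor[of D n n] by (auto simp: neg_roots_def)
  have "even (card (neg_roots D n)) \<longleftrightarrow> even (card {r \<in> neg_roots D n. n - r = r})"
  proof (rule even_card_involution)
    fix r assume r: "r \<in> neg_roots D n"
    have "n dvd (- r)\<^sup>2 + D"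
      using r by (simp add: neg_roots_def)
    then have "n dvd (n - r)\<^sup>2 + D"
      by (subst dvd_square_plus_cong[of _ "- r"]) (auto simp: cong_iff_dvd_diff)
    then show "n - r \<in> neg_roots D n"
      using r nz by (auto simp: neg_roots_def order.strict_iff_order)
  qed auto
  also have "{r \<in> neg_roots D n. n - r = r} = {}"
    using assms(2) by (auto simp: algebra_simps)
  finally show ?thesis
    by simp
qed

text \<open>For two roots, \<open>p ^ e\<close> divides \<open>(r - s) * (r + s)\<close>. If
  \<open>e > 0\<close> then \<open>p\<close> cannot divide both factors, since it would divide
  \<open>r\<close> and hence \<open>D\<close>; so the whole power divides one of them.\<close>

lemma card_neg_roots_prime_power_le:
  assumes "prime p" "odd p" "\<not> p dvd D"
  shows "card (neg_roots D (p ^ e)) \<le> 2"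
proof (cases "neg_roots D (p ^ e) = {}")
  case False
  then obtain r where r: "r \<in> neg_roots D (p ^ e)"
    by blast
  have p0: "p > 0"
    using assms(1) by (rule prime_gt_0_int)
  have "neg_roots D (p ^ e) \<subseteq> {r, (- r) mod p ^ e}"
  proof (cases "e = 0")
    case True
    then show ?thesis using r by (auto simp: neg_roots_def)
  next
    case e: False
    show ?thesis
    proof
    fix s assume s: "s \<in> neg_roots D (p ^ e)"
    have "p ^ e dvd (r\<^sup>2 + D) - (s\<^sup>2 + D)"
      using r s by (intro dvd_diff) (auto simp: neg_roots_def)
    then have dvd: "p ^ e dvd (r - s) * (r + s)"
      by (simp add: algebra_simps power2_eq_square)
    have "\<not> (p dvd r - s \<and> p dvd r + s)"
    proof
      assume "p dvd r - s \<and> p dvd r + s"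
      moreover have "(r - s) + (r + s) = 2 * r"
        by simp
      ultimately have "p dvd 2 * r"
        by (metis dvd_add)
      then have "p dvd r"
        using assms(2) by (simp add: coprime_dvd_mult_right_iff)
      moreover have "p dvd r\<^sup>2 + D"
        using r e by (auto simp: neg_roots_def intro: dvd_trans[OF dvd_power])
      ultimately show False
        using assms(3) by (simp add: dvd_add_right_iff power2_eq_square)
    qed
    then consider "coprime (p ^ e) (r - s)" | "coprime (p ^ e) (r + s)"
      using assms(1) by (metis coprime_power_left_iff prime_imp_coprime)
    then have "[s = r] (mod p ^ e) \<or> [s = - r] (mod p ^ e)"
    proof cases
      case 1
      then have "p ^ e dvd r + s"
        using dvd coprime_dvd_mult_right_iff by blast
      then show ?thesis
        by (simp add: cong_iff_dvd_diff add.commute)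
    next
      case 2
      then have "p ^ e dvd r - s"
        using dvd coprime_dvd_mult_left_iff by blast
      then show ?thesis
        by (simp add: cong_iff_dvd_diff dvd_diff_commute)
    qed
    then show "s \<in> {r, (- r) mod p ^ e}"
      using r s by (auto simp: neg_roots_def cong_def)
    qed
  qed
  then have "card (neg_roots D (p ^ e)) \<le> card {r, (- r) mod p ^ e}"
    by (intro card_mono) auto
  also have "\<dots> \<le> 2"
    by (simp add: card_insert_le_m1)
  finally show ?thesis .
qed simp

text \<open>Hensel lifting, one power of \<open>p\<close> at a time; it works because the derivative
  \<open>2 * s\<close> is a unit modulo \<open>p\<close>.\<close>

lemma hensel_square_plus:
  assumes "prime p" "odd p" "\<not> p dvd D" "p dvd r\<^sup>2 + D" "e > 0"
  shows "\<exists>s. p ^ e dvd s\<^sup>2 + (D :: int)"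
  using assms(5)
proof (induction e rule: nat_induct_non_zero)
  case 1
  then show ?case using assms(4) by auto
next
  case (Suc e)
  then obtain s w where w: "s\<^sup>2 + D = p ^ e * w"
    by (auto elim: dvdE)
  have ps: "\<not> p dvd 2 * s"
  proof
    assume "p dvd 2 * s"
    then have "p dvd s"
      using assms(2) by (simp add: coprime_dvd_mult_right_iff)
    moreover have "p dvd s\<^sup>2 + D"
      using w Suc by simp
    ultimately show False
      using assms(3) by (simp add: dvd_add_right_iff power2_eq_square)
  qed
  then have "coprime (2 * s) p"
    using assms(1) by (metis prime_imp_coprime coprime_commute)
  \<comment> \<open>Newton correction: the linear part of \<open>(s + p ^ e * t)^2 + D\<close> is
    \<open>p ^ e * (w + 2 * s * t)\<close>, and this choice gains one more factor
    \<open>p\<close>.\<close>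
  then obtain t where t: "[2 * s * t = - w] (mod p)"
    using cong_solve_coprime_int cong_scalar_right
    by (metis mult.assoc mult_1)
  have "p dvd w + 2 * s * t"
    using t by (simp add: cong_iff_dvd_diff add.commute)
  then obtain m where m: "w + 2 * s * t = p * m"
    by (auto elim: dvdE)
  have "e + e = Suc e + (e - 1)"
    using Suc by simp
  then have pp: "p ^ e * p ^ e = p ^ Suc e * p ^ (e - 1)"
    by (simp only: power_add[symmetric])
  have "(s + p ^ e * t)\<^sup>2 + D = (s\<^sup>2 + D) + p ^ e * (2 * s * t) + (p ^ e * p ^ e) * t\<^sup>2"
    by (simp add: power2_eq_square algebra_simps)
  also have "\<dots> = p ^ e * (w + 2 * s * t) + p ^ Suc e * p ^ (e - 1) * t\<^sup>2"
    unfolding w pp by (simp add: distrib_left)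
  also have "\<dots> = p ^ Suc e * (m + p ^ (e - 1) * t\<^sup>2)"
    unfolding m by (simp add: algebra_simps)
  finally show ?case
    by (metis dvd_triv_left)
qed

text \<open>The count is even and at most 2, so it is 0 or 2, and Hensel lifting lets the residue
  modulo \<open>p\<close> decide which.\<close>

lemma card_neg_roots_prime_power:
  assumes "prime p" "odd p" "\<not> p dvd D" "e > 0"
  shows "card (neg_roots D (p ^ e)) = (if QuadRes p (- D) then 2 else 0)"
proof -
  have p1: "p > 1"
    using assms(1) by (rule prime_gt_1_int)
  have pe: "p ^ e > 1"
    using p1 assms(4) by (rule one_less_power)
  have ne: "neg_roots D (p ^ e) \<noteq> {} \<longleftrightarrow> QuadRes p (- D)"
  proof
    assume "neg_roots D (p ^ e) \<noteq> {}"
    then obtain r where "p ^ e dvd r\<^sup>2 + D"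
      by (auto simp: neg_roots_def)
    then have "p dvd r\<^sup>2 + D"
      using assms(4) dvd_power dvd_trans by blast
    then show "QuadRes p (- D)"
      by (auto simp: QuadRes_def cong_iff_dvd_diff)
  next
    assume "QuadRes p (- D)"
    then obtain r where "p dvd r\<^sup>2 + D"
      by (auto simp: QuadRes_def cong_iff_dvd_diff)
    then obtain s where "p ^ e dvd s\<^sup>2 + D"
      using hensel_square_plus assms by blast
    then have "s mod p ^ e \<in> neg_roots D (p ^ e)"
      using pe by (intro neg_roots_mod) auto
    then show "neg_roots D (p ^ e) \<noteq> {}"
      by blast
  qed
  have "coprime D (p ^ e)"
    using assms by (metis coprime_commute coprime_power_right_iff prime_imp_coprime)
  then have "even (card (neg_roots D (p ^ e)))"
    using assms pe by (intro even_card_neg_roots) auto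
  moreover have "card (neg_roots D (p ^ e)) \<le> 2"
    using assms by (intro card_neg_roots_prime_power_le) auto
  ultimately have "card (neg_roots D (p ^ e)) = 0 \<or> card (neg_roots D (p ^ e)) = 2"
    by presburger
  then show ?thesis
    using ne by auto
qed

text \<open>Splitting off the full power of one prime leaves a cofactor that is 1 or coprime to it.
  In the second case two even root counts multiply to a multiple of 4.\<close>

lemma prime_power_or_coprime_factors:
  fixes n :: int
  assumes "n > 1" "odd n"
  obtains (prime_power) p e where "prime p" "e > 0" "n = p ^ e"
    | (product) u v where "n = u * v" "coprime u v" "u > 1" "v > 1"
proof -
  obtain p where p: "prime p" "p dvd n"
    using assms(1) prime_factor_int[of n] by auto
  have p1: "p > 1"
    using p(1) by (rule prime_gt_1_int)
  obtain v where v: "n = p ^ multiplicity p n * v" "\<not> p dvd v"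
    using multiplicity_decompose'[of n p] assms(1) p1 by auto
  have e: "multiplicity p n > 0"
    using p assms(1) by (metis less_irrefl not_less prime_multiplicity_gt_zero_iff prime_elem_multiplicity_eq_zero_iff prime_imp_prime_elem not_gr_zero zero_less_one order.strict_trans)
  have pe: "p ^ multiplicity p n > 1"
    using p1 e by (rule one_less_power)
  have "v > 0"
    using v(1) assms(1) pe by (metis less_trans zero_less_mult_pos zero_less_one)
  show ?thesis
  proof (cases "v = 1")
    case True
    then show ?thesis
      using v p e by (intro prime_power[of p "multiplicity p n"]) auto
  next
    case False
    then show ?thesis
      using v p pe \<open>v > 0\<close>
      by (intro product[of "p ^ multiplicity p n" v]) (auto simp: prime_imp_coprime coprime_power_left_iff)
  qed
qed

lemma four_dvd_card_neg_roots_mult: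
  assumes "coprime u v" "coprime D (u * v)" "odd (u * v)" "u > 1" "v > 1"
  shows "4 dvd card (neg_roots D (u * v))"
proof -
  have "even (card (neg_roots D u))" "even (card (neg_roots D v))"
    using assms by (auto intro!: even_card_neg_roots)
  then have "2 * 2 dvd card (neg_roots D u) * card (neg_roots D v)"
    by (rule mult_dvd_mono)
  then show ?thesis
    using assms by (simp add: card_neg_roots_mult)
qed

section \<open>Legendre symbols and residue classes modulo 12\<close>

text \<open>By Euler's criterion both sides agree modulo \<open>p\<close>; their difference is at
  most 2 in absolute value, hence smaller than \<open>p\<close>.\<close>

lemma Legendre_mult:
  assumes "prime p" "2 < p"
  shows "Legendre (a * b) (int p) = Legendre a (int p) * Legendre b (int p)"
proof -
  let ?k = "(p - 1) div 2"
  have "[Legendre (a * b) (int p) = (a * b) ^ ?k] (mod int p)"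
    using assms by (intro euler_criterion) auto
  moreover have "[Legendre a (int p) * Legendre b (int p) = a ^ ?k * b ^ ?k] (mod int p)"
    using assms by (intro cong_mult euler_criterion) auto
  ultimately have "int p dvd Legendre (a * b) (int p) - Legendre a (int p) * Legendre b (int p)"
    by (metis cong_iff_dvd_diff cong_sym cong_trans power_mult_distrib)
  moreover have "\<bar>Legendre (a * b) (int p) - Legendre a (int p) * Legendre b (int p)\<bar> < int p"
    using assms by (auto simp: Legendre_def)
  ultimately show ?thesis
    by (metis abs_of_nat dvd_imp_le_int eq_iff_diff_eq_0 not_le)
qed

lemma Legendre_eq_1_iff: "\<not> p dvd a \<Longrightarrow> Legendre a p = 1 \<longleftrightarrow> QuadRes p a"
  by (auto simp: Legendre_def cong_0_iff)

lemma Legendre_cases: "\<not> p dvd a \<Longrightarrow> Legendre a p = 1 \<or> Legendre a p = -1"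
  by (auto simp: Legendre_def cong_0_iff)

lemma Legendre_square: "\<not> p dvd a \<Longrightarrow> prime p \<Longrightarrow> Legendre (a * a) p = 1"
  by (subst Legendre_eq_1_iff) (auto simp: prime_dvd_mult_iff QuadRes_def power2_eq_square intro!: exI[of _ a])

lemma Legendre_neg_1:
  assumes "prime p" "p mod 4 = 1"
  shows "Legendre (- 1) (int p) = 1"
proof -
  have "2 < p"
    using assms prime_ge_2_nat[of p] by (cases "p = 2") auto
  have "even ((p - 1) div 2)"
    using assms(2) by presburger
  then have "[Legendre (- 1) (int p) = 1] (mod int p)"
    using euler_criterion[OF assms(1) \<open>2 < p\<close>, of "- 1"] by simp
  moreover have "\<not> [- 1 = 1] (mod int p)"
    using \<open>2 < p\<close> by (auto simp: cong_iff_dvd_diff dest: zdvd_imp_le)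
  moreover have "\<not> [0 = 1] (mod int p)"
    using \<open>2 < p\<close> by (auto simp: cong_iff_dvd_diff)
  ultimately show ?thesis
    by (auto simp: Legendre_def split: if_splits)
qed

lemma QuadRes_3: "QuadRes 3 a \<longleftrightarrow> a mod 3 \<noteq> 2"
proof
  assume "QuadRes 3 a"
  then obtain y where "[y\<^sup>2 = a] (mod 3)"
    by (auto simp: QuadRes_def)
  moreover have "y\<^sup>2 mod 3 \<noteq> 2"
  proof -
    have "y mod 3 \<in> {0, 1, 2}" by auto
    then have "(y mod 3)\<^sup>2 mod 3 \<noteq> 2" by auto
    then show ?thesis by (simp add: power_mod)
  qed
  ultimately show "a mod 3 \<noteq> 2"
    by (simp add: cong_def)
next
  assume "a mod 3 \<noteq> 2"
  then have "a mod 3 = 0 \<or> a mod 3 = 1" by presburger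
  then have "[0\<^sup>2 = a] (mod 3) \<or> [1\<^sup>2 = a] (mod 3)"
    by (auto simp: cong_def)
  then show "QuadRes 3 a"
    unfolding QuadRes_def by blast
qed

text \<open>Quadratic reciprocity: in both classes \<open>p\<close> is 2 modulo 3, a nonresidue, and
  the sign \<open>(- 1) ^ ((p - 1) div 2)\<close> tells 5 from 11.\<close>

lemma Legendre_3:
  assumes "prime p" "p mod 12 = 5 \<or> p mod 12 = 11"
  shows "Legendre 3 (int p) = (if p mod 12 = 5 then - 1 else 1)"
proof -
  have p: "2 < p" "p \<noteq> 3"
    using assms prime_ge_2_nat[of p] by (cases "p = 2"; auto)+
  have "\<not> QuadRes 3 (int p)"
    using assms(2) unfolding QuadRes_3 by presburger
  moreover have "\<not> 3 dvd int p"
    using assms(2) by presburger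
  ultimately have "Legendre (int p) 3 = - 1"
    by (auto simp: Legendre_def cong_0_iff)
  moreover have "Legendre (int p) (int 3) * Legendre (int 3) (int p)
      = (- 1) ^ ((p - 1) div 2 * ((3 - 1) div 2))"
    using assms(1) p by (intro Quadratic_Reciprocity) auto
  moreover have "even ((p - 1) div 2) \<longleftrightarrow> p mod 12 = 5"
    using assms(2) by presburger
  ultimately show ?thesis
    by auto
qed

text \<open>Every unit modulo 12 squares to 1. Hence a power in a class other than 1 reveals the
  class of its base.\<close>

lemma power_mod_12:
  fixes p :: int
  assumes "p mod 12 \<in> {1, 5, 7, 11}"
  shows "p ^ e mod 12 = 1 \<or> p ^ e mod 12 = p mod 12"
proof (induction e)
  case (Suc e)
  have "p ^ Suc e mod 12 = ((p mod 12) * (p ^ e mod 12)) mod 12"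
    by (simp add: mod_mult_eq)
  then show ?case
    using Suc assms by auto
qed simp

lemma mod_12_cases:
  fixes p :: int
  assumes "odd p" "\<not> 3 dvd p"
  shows "p mod 12 \<in> {1, 5, 7, 11}"
proof -
  have *: "m \<in> {1, 5, 7, 11}" if "m \<in> set [0..11]" "m mod 2 \<noteq> 0" "m mod 3 \<noteq> 0" for m :: int
    using that by (auto simp add: upto_rec1 simp del: set_upto)
  have "p mod 12 mod 2 = p mod 2" "p mod 12 mod 3 = p mod 3"
    by (simp_all add: mod_mod_cancel)
  then have "p mod 12 mod 2 \<noteq> 0" "p mod 12 mod 3 \<noteq> 0"
    using assms by (metis dvd_eq_mod_eq_0)+
  then show ?thesis
    by (intro *) (simp_all add: pos_mod_bound)
qed

lemma mod_12_imp:
  fixes n :: int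
  assumes "n mod 12 = 5 \<or> n mod 12 = 11"
  shows "odd n" "\<not> 3 dvd n"
proof -
  have "n mod 2 = n mod 12 mod 2" "n mod 3 = n mod 12 mod 3"
    by (simp_all add: mod_mod_cancel)
  then have "n mod 2 \<noteq> 0" "n mod 3 \<noteq> 0"
    using assms by auto
  then show "odd n" "\<not> 3 dvd n"
    by (auto simp: dvd_eq_mod_eq_0)
qed

lemma prime_power_mod_12:
  fixes p :: int
  assumes "p ^ e mod 12 = c" "e > 0" "c = 5 \<or> c = 11"
  shows "p mod 12 = c"
proof -
  note pe = mod_12_imp[of "p ^ e"]
  have "odd (p ^ e)"
    using assms pe by blast
  then have "odd p"
    using assms(2) by simp
  have "\<not> 3 dvd p ^ e"
    using assms pe by blast
  then have "\<not> 3 dvd p"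
    using assms(2) dvd_power dvd_trans by blast
  with \<open>odd p\<close> have "p mod 12 \<in> {1, 5, 7, 11}"
    by (rule mod_12_cases)
  then show ?thesis
    using power_mod_12[of p e] assms by auto
qed

lemma coprime_9_19_57:
  fixes n :: int
  assumes "n mod 12 = 5 \<or> n mod 12 = 11" "\<not> 19 dvd n"
  shows "coprime 9 n" "coprime 19 n" "coprime 57 n"
proof -
  have "prime (3 :: int)" "prime (19 :: int)"
    by (simp_all add: prime_int_numeral_eq)
  moreover have "\<not> 3 dvd n"
    using assms(1) by (rule mod_12_imp)
  ultimately have "coprime 3 n" and "coprime 19 n"
    using assms(2) by (auto intro: prime_imp_coprime)
  moreover have "(9 :: int) = 3 * 3" "(57 :: int) = 3 * 19"
    by auto
  ultimately show "coprime 9 n" "coprime 19 n" "coprime 57 n"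
    by (simp_all only: coprime_mult_left_iff)
qed

text \<open>Multiplicativity of the Legendre symbol applied to \<open>- 9 = - 1 * (3 * 3)\<close>
  and \<open>- 57 = - 19 * 3\<close>. The symbol of 3 depends on the class modulo 12, and in class 5
  the prime is 1 modulo 4, so that -1 is a square.\<close>

lemma QuadRes_mod_12:
  assumes "prime p" "p mod 12 = 5 \<or> p mod 12 = 11" "p \<noteq> 19"
  shows "p mod 12 = 5 \<Longrightarrow> QuadRes p (- 9)"
    and "QuadRes p (- 57) \<longleftrightarrow> (QuadRes p (- 19) \<longleftrightarrow> p mod 12 = 11)"
proof -
  define q where "q = nat p"
  have q: "p = int q" "prime q"
    using assms(1) by (auto simp: q_def prime_ge_0_int)
  have q12: "p mod 12 = int (q mod 12)"
    unfolding q(1) by (simp add: zmod_int)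
  have m: "q mod 12 = 5 \<or> q mod 12 = 11"
    using assms(2) unfolding q12 by linarith
  have q2: "2 < q"
    using q(2) m prime_ge_2_nat[of q] by (cases "q = 2") auto
  have np: "\<not> p dvd 19"
  proof
    assume "p dvd 19"
    then have "p = 19"
      using assms(1) by (intro primes_dvd_imp_eq) (auto simp: prime_int_numeral_eq)
    then show False
      using assms(3) by simp
  qed
  have n3: "\<not> p dvd 3"
  proof
    assume "p dvd 3"
    then have "p = 3"
      using assms(1) by (intro primes_dvd_imp_eq) (auto simp: prime_int_numeral_eq)
    then show False
      using assms(2) by simp
  qed
  have n: "\<not> p dvd - 19" "\<not> p dvd - 57" "\<not> p dvd - 9"
    using np n3 assms(1) prime_dvd_mult_iff[of p 3 19] prime_dvd_mult_iff[of p 3 3] by auto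
  have l3: "Legendre 3 p = (if p mod 12 = 5 then - 1 else 1)"
    using Legendre_3[OF q(2) m] by (auto simp: q12 q(1)[symmetric])
  have mult: "Legendre (a * b) p = Legendre a p * Legendre b p" for a b
    unfolding q(1) using q(2) q2 by (rule Legendre_mult)
  {
    assume "p mod 12 = 5"
    then have "q mod 12 = 5"
      unfolding q12 by linarith
    moreover have "q mod 12 mod 4 = q mod 4"
      by (simp add: mod_mod_cancel)
    ultimately have "q mod 4 = 1"
      by simp
    then have "Legendre (- 1) p = 1"
      unfolding q(1) by (rule Legendre_neg_1[OF q(2)])
    then have "Legendre (- 9) p = 1"
      using mult[of "- 1" "3 * 3"] Legendre_square[OF n3 assms(1)] by simp
    then show "QuadRes p (- 9)"
      using n by (simp add: Legendre_eq_1_iff)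
  }
  have "Legendre (- 57) p = Legendre (- 19) p * Legendre 3 p"
    using mult[of "- 19" 3] by simp
  then show "QuadRes p (- 57) \<longleftrightarrow> (QuadRes p (- 19) \<longleftrightarrow> p mod 12 = 11)"
    using l3 n Legendre_cases[of p "- 19"] assms(2)
    by (auto simp: Legendre_eq_1_iff[symmetric])
qed

section \<open>The total number of square roots of -9, -19 and -57\<close>

text \<open>With two coprime factors each count is a multiple of 4. For a prime power each count is
  0 or 2: in class 5, -9 is a residue together with exactly one of -19 and -57; in class 11, -19 and
  -57 are residues together or not at all. Class 11 arises when a factor 19 is removed from a number
  in class 5.\<close>

lemma four_dvd_card_neg_roots_coprime:
  assumes "n > 1" "n mod 12 = 5 \<or> n mod 12 = 11" "\<not> 19 dvd n"
  shows "4 dvd card (neg_roots 19 n) + card (neg_roots 57 n)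
    + (if n mod 12 = 5 then card (neg_roots 9 n) else 0)"
proof -
  have odd: "odd n"
    using assms(2) by (rule mod_12_imp)
  note cop = coprime_9_19_57[OF assms(2,3)]
  show ?thesis
    using assms(1) odd
  proof (cases rule: prime_power_or_coprime_factors)
    case (prime_power p e)
    have p: "p mod 12 = n mod 12"
      using prime_power assms(2) by (intro prime_power_mod_12[of p e]) auto
    have p19: "p \<noteq> 19"
      using prime_power assms(3) by auto
    have "odd p"
      using odd prime_power by simp
    have "\<not> p dvd D" if "coprime D n" for D
    proof
      assume "p dvd D"
      moreover have "p dvd n"
        using prime_power by simp
      ultimately have "is_unit p"
        using that by (metis coprime_common_divisor)
      then show False
        using prime_power by auto
    qed
    then have "card (neg_roots D n) = (if QuadRes p (- D) then 2 else 0)" if "coprime D n" for D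
      using that prime_power \<open>odd p\<close> by (simp add: card_neg_roots_prime_power)
    with cop have card: "card (neg_roots 9 n) = (if QuadRes p (- 9) then 2 else 0)"
      "card (neg_roots 19 n) = (if QuadRes p (- 19) then 2 else 0)"
      "card (neg_roots 57 n) = (if QuadRes p (- 57) then 2 else 0)"
      by blast+
    have "p mod 12 = 5 \<or> p mod 12 = 11"
      using p assms(2) by simp
    note QR = QuadRes_mod_12[OF prime_power(1) this p19]
    show ?thesis
    proof (cases "n mod 12 = 5")
      case True
      then have "card (neg_roots 19 n) + card (neg_roots 57 n) = 2" "card (neg_roots 9 n) = 2"
        using QR p unfolding card by auto
      then show ?thesis
        using True by simp
    next
      case False
      then have "card (neg_roots 19 n) + card (neg_roots 57 n) = (if QuadRes p (- 19) then 4 else 0)"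
        using QR p assms(2) unfolding card by auto
      then show ?thesis
        using False by simp
    qed
  next
    case (product u v)
    have "4 dvd card (neg_roots D n)" if "coprime D n" for D
      unfolding product(1) using product odd that by (intro four_dvd_card_neg_roots_mult) auto
    then show ?thesis
      using cop by auto
  qed
qed

lemma not_19_dvd_square_plus_9: "\<not> 19 dvd r\<^sup>2 + (9 :: int)"
proof -
  have "r mod 19 \<in> {0..<19}"
    by simp
  also have "{0..<19 :: int} = set [0..18]"
    by auto
  also have "\<dots> = {0,1,2,3,4,5,6,7,8,9,10,11,12,13,14,15,16,17,18}"
    by (simp add: upto_rec1 del: set_upto)
  finally have "r mod 19 \<in> {0,1,2,3,4,5,6,7,8,9,10,11,12,13,14,15,16,17,18}" .
  then have "((r mod 19)\<^sup>2 + 9) mod 19 \<noteq> 0"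
    by auto
  then show ?thesis
    by (metis dvd_eq_mod_eq_0 mod_add_left_eq power_mod)
qed

lemma four_dvd_card_neg_roots:
  assumes "n > 0" "n mod 12 = 5"
  shows "4 dvd card (neg_roots 9 n) + card (neg_roots 19 n) + card (neg_roots 57 n)"
proof (cases "19 dvd n")
  case False
  have "n > 1"
    using assms by (cases "n = 1") auto
  then show ?thesis
    using four_dvd_card_neg_roots_coprime[of n] assms False by (auto simp: ac_simps)
next
  case True
  then obtain v where v: "n = 19 * v"
    by (auto elim: dvdE)
  have prime: "prime (19 :: int)"
    by (simp add: prime_int_numeral_eq)
  have "neg_roots 9 n = {}"
    using not_19_dvd_square_plus_9 True by (auto simp: neg_roots_def dest: dvd_trans)
  have r0: "19 dvd r" if "19 dvd r\<^sup>2 + D" "19 dvd D" for r D :: int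
    using that prime prime_dvd_power by (metis dvd_add_left_iff)
  show ?thesis
  proof (cases "19 dvd v")
    case True
    then obtain w where w: "n = 361 * w"
      using v by (auto elim!: dvdE)
    \<comment> \<open>A root would be divisible by 19, so 361 would divide its square and therefore
      \<open>D\<close>; neither 19 nor 57 allows this.\<close>
    have "neg_roots D n = {}" if "19 dvd D" "\<not> 361 dvd D" for D
    proof (rule equals0I)
      fix r assume "r \<in> neg_roots D n"
      then have r: "361 dvd r\<^sup>2 + D"
        unfolding w by (auto simp: neg_roots_def dest: dvd_mult_left)
      then have "19 dvd r\<^sup>2 + D"
        by (rule dvd_trans[rotated]) simp
      then have "19 dvd r"
        using r0 that by blast
      then have "361 dvd r\<^sup>2"
        by (auto elim!: dvdE simp: power2_eq_square)
      then show False
        using r that by (simp add: dvd_add_right_iff)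
    qed
    then show ?thesis
      using \<open>neg_roots 9 n = {}\<close> by simp
  next
    case False
    then have cop: "coprime 19 v"
      using prime by (rule prime_imp_coprime[rotated])
    have v0: "v > 0"
      using v assms by simp
    \<comment> \<open>7 is the inverse of 19 modulo 12, so \<open>v\<close> lies in the class of
      \<open>7 * 5\<close>, which is 11.\<close>
    have "7 * n = v + 12 * (11 * v)"
      using v by simp
    then have "(7 * n) mod 12 = v mod 12"
      by (simp only: mod_mult_self2)
    moreover have "(7 * n) mod 12 = (7 * (n mod 12)) mod 12"
      by (simp add: mod_mult_right_eq)
    ultimately have vm: "v mod 12 = 11"
      using assms(2) by simp
    then have v1: "v > 1"
      using v0 by (cases "v = 1") auto
    \<comment> \<open>There is a single root modulo 19, so the factor 19 does not change the counts
      for 19 and 57.\<close>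
    have "neg_roots D 19 = {0}" if "19 dvd D" for D
    proof (intro equalityI subsetI)
      fix r assume "r \<in> neg_roots D 19"
      then have "0 \<le> r" "r < 19" "19 dvd r\<^sup>2 + D"
        by (auto simp: neg_roots_def)
      moreover from this(3) that have "19 dvd r"
        by (rule r0)
      ultimately show "r \<in> {0}"
        using zdvd_not_zless[of r 19] by (cases "r = 0") auto
    qed (use that in \<open>auto simp: neg_roots_def\<close>)
    then have "card (neg_roots D n) = card (neg_roots D v)" if "19 dvd D" for D
      unfolding v using cop v0 that by (simp add: card_neg_roots_mult)
    then show ?thesis
      using four_dvd_card_neg_roots_coprime[of v] vm v1 False \<open>neg_roots 9 n = {}\<close> by auto
  qed
qed

section \<open>Representations by binary forms\<close>

text \<open>Pigeonhole principle for \<open>x - r * y\<close> modulo \<open>n\<close> on a box of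
  more than \<open>n\<close> points; the weight \<open>t\<close> trades the range of
  \<open>x\<close> against that of \<open>y\<close>.\<close>

lemma thue:
  fixes n t r :: int
  assumes "n > 0" "t > 0"
  obtains x y where "x \<noteq> 0 \<or> y \<noteq> 0" "n dvd x - r * y" "x\<^sup>2 < t * n" "t * y\<^sup>2 \<le> n"
proof -
  define P where "P k \<longleftrightarrow> n < t * (int k + 1)\<^sup>2" for k
  have "P (nat n)"
  proof -
    have "n < (n + 1)\<^sup>2"
      using assms by (simp add: power2_eq_square algebra_simps add_pos_pos)
    also have "\<dots> \<le> t * (n + 1)\<^sup>2"
      using assms by (intro mult_le_cancel_right1[THEN iffD2]) auto
    finally show ?thesis
      using assms by (simp add: P_def)
  qed
  define Y where "Y = (LEAST k. P k)"
  have Y: "n < t * (int Y + 1)\<^sup>2"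
    using LeastI[of P, OF \<open>P (nat n)\<close>] by (simp add: P_def Y_def)
  have Y': "t * (int Y)\<^sup>2 \<le> n"
  proof (cases Y)
    case 0
    then show ?thesis using assms by simp
  next
    case (Suc k)
    then have "\<not> P k"
      using not_less_Least[of k P] by (simp add: Y_def)
    then show ?thesis
      by (simp add: P_def Suc add.commute)
  qed
  \<comment> \<open>\<open>Y\<close> is the largest integer with \<open>t * Y^2 \<le> n\<close>.
    Taking \<open>X\<close> as this quotient makes \<open>(X + 1) * (Y + 1)\<close> just exceed
    \<open>n\<close> while keeping \<open>X^2 < t * n\<close>.\<close>
  define X where "X = n div (int Y + 1)"
  have X: "X * (int Y + 1) \<le> n" "n < (X + 1) * (int Y + 1)"
  proof -
    define m where "m = int Y + 1"
    have "m > 0"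
      by (simp add: m_def)
    then have "X * m + n mod m = n" "0 \<le> n mod m" "n mod m < m"
      unfolding X_def m_def[symmetric] by simp_all
    then show "X * (int Y + 1) \<le> n" "n < (X + 1) * (int Y + 1)"
      unfolding m_def[symmetric] distrib_right by linarith+
  qed
  have X0: "X \<ge> 0"
    using assms by (simp add: X_def pos_imp_zdiv_nonneg_iff)
  define A where "A = {0..X} \<times> {0..int Y}"
  define f where "f = (\<lambda>(x, y). (x - r * y) mod n)"
  have "f ` A \<subseteq> {0..<n}"
    using assms by (auto simp: f_def)
  then have "card (f ` A) \<le> nat n"
    using card_mono[of "{0..<n}" "f ` A"] by simp
  also have "\<dots> < nat ((X + 1) * (int Y + 1))"
    using X assms by (simp add: nat_less_eq_zless)
  also have "\<dots> = card A"
    using X0 by (simp add: A_def nat_mult_distrib)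
  finally have "\<not> inj_on f A"
    by (rule pigeonhole)
  then obtain a b c d where ab: "(a, b) \<in> A" "(c, d) \<in> A" "(a, b) \<noteq> (c, d)" "f (a, b) = f (c, d)"
    unfolding inj_on_def by force
  have "n dvd (a - r * b) - (c - r * d)"
    using ab(4) by (simp add: f_def mod_eq_dvd_iff)
  then have 1: "n dvd (a - c) - r * (b - d)"
    by (simp add: algebra_simps)
  have "\<bar>a - c\<bar> \<le> X" "\<bar>b - d\<bar> \<le> int Y"
    using ab by (auto simp: A_def)
  then have 2: "(a - c)\<^sup>2 \<le> X\<^sup>2" "(b - d)\<^sup>2 \<le> (int Y)\<^sup>2"
    using X0 by (auto simp flip: abs_le_square_iff)
  have 3: "X\<^sup>2 < t * n"
  proof (cases "X = 0")
    case True
    then show ?thesis using assms by simp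
  next
    case False
    then have "X\<^sup>2 * n < X\<^sup>2 * (t * (int Y + 1)\<^sup>2)"
      using Y by simp
    also have "\<dots> = t * (X * (int Y + 1))\<^sup>2"
      by (simp add: power_mult_distrib)
    also have "\<dots> \<le> t * n\<^sup>2"
      using X X0 assms by (intro mult_left_mono power_mono) auto
    finally show ?thesis
      using assms by (simp add: power2_eq_square flip: mult.assoc)
  qed
  have "t * (b - d)\<^sup>2 \<le> t * (int Y)\<^sup>2"
    using 2 assms by (intro mult_left_mono) auto
  then show ?thesis
    using that[of "a - c" "b - d"] 1 2 3 Y' ab(3) by auto
qed

text \<open>Since \<open>x\<close> is \<open>r * y\<close> modulo \<open>n\<close>, the norm is a
  multiple \<open>k * n\<close>. The box bounds give \<open>k < t + D / t\<close>, stated without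
  division; it is sharpest for \<open>t\<close> near the square root of \<open>D\<close>.\<close>

lemma thue_norm:
  fixes n t r D :: int
  assumes "n > 0" "t > 0" "D > 0" "n dvd r\<^sup>2 + D"
  obtains x y k where "n dvd x - r * y" "x\<^sup>2 + D * y\<^sup>2 = k * n" "k > 0" "t * k < t * t + D"
proof -
  obtain x y where xy: "x \<noteq> 0 \<or> y \<noteq> 0" "n dvd x - r * y" "x\<^sup>2 < t * n" "t * y\<^sup>2 \<le> n"
    using thue[OF assms(1,2)] by blast
  have "x\<^sup>2 + D * y\<^sup>2 = (x - r * y) * (x + r * y) + (r\<^sup>2 + D) * y\<^sup>2"
    by (simp add: power2_eq_square algebra_simps)
  also have "n dvd \<dots>"
    using dvd_mult2[OF xy(2)] dvd_mult2[OF assms(4)] by (rule dvd_add)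
  finally obtain k where k: "x\<^sup>2 + D * y\<^sup>2 = k * n"
    by (metis dvd_def mult.commute)
  have "0 < k * n"
    unfolding k[symmetric] using xy(1) assms(3)
    by (metis add_pos_nonneg add_nonneg_pos mult_nonneg_nonneg mult_pos_pos order_less_imp_le
        zero_le_power2 zero_less_power2)
  then have "k > 0"
    using assms(1) zero_less_mult_pos2 by blast
  have "t * k * n = t * (x\<^sup>2 + D * y\<^sup>2)"
    unfolding k by simp
  also have "\<dots> = t * x\<^sup>2 + D * (t * y\<^sup>2)"
    by (simp add: algebra_simps)
  also have "\<dots> < t * (t * n) + D * n"
    using xy assms by (intro add_less_le_mono mult_strict_left_mono mult_left_mono) auto
  also have "\<dots> = (t * t + D) * n"
    by (simp add: algebra_simps)
  finally have "t * k < t * t + D"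
    using assms(1) by simp
  then show ?thesis
    using that xy k \<open>k > 0\<close> by blast
qed

section \<open>Small multiples of n represented by the three forms\<close>

lemma square_mod_3: "(x :: int)\<^sup>2 mod 3 \<in> {0, 1}"
proof -
  have *: "m\<^sup>2 mod 3 \<in> {0, 1}" if "m \<in> set [0..2]" for m :: int
    using that by (auto simp: upto_rec1 simp del: set_upto)
  show ?thesis
    using *[of "x mod 3"] by (simp add: power_mod pos_mod_bound)
qed

lemma square_mod_4: "(x :: int)\<^sup>2 mod 4 \<in> {0, 1}"
proof -
  have *: "m\<^sup>2 mod 4 \<in> {0, 1}" if "m \<in> set [0..3]" for m :: int
    using that by (auto simp: upto_rec1 simp del: set_upto)
  show ?thesis
    using *[of "x mod 4"] by (simp add: power_mod pos_mod_bound)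
qed

lemma square_mod_5: "(x :: int)\<^sup>2 mod 5 \<in> {0, 1, 4}"
proof -
  have *: "m\<^sup>2 mod 5 \<in> {0, 1, 4}" if "m \<in> set [0..4]" for m :: int
    using that by (auto simp: upto_rec1 simp del: set_upto)
  show ?thesis
    using *[of "x mod 5"] by (simp add: power_mod pos_mod_bound)
qed

lemma square_mod_8: "(x :: int)\<^sup>2 mod 8 \<in> {0, 1, 4}"
proof -
  have *: "m\<^sup>2 mod 8 \<in> {0, 1, 4}" if "m \<in> set [0..7]" for m :: int
    using that by (auto simp: upto_rec1 simp del: set_upto)
  show ?thesis
    using *[of "x mod 8"] by (simp add: power_mod pos_mod_bound)
qed

lemma square_mod_9: "(x :: int)\<^sup>2 mod 9 \<in> {0, 1, 4, 7}"
proof -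
  have *: "m\<^sup>2 mod 9 \<in> {0, 1, 4, 7}" if "m \<in> set [0..8]" for m :: int
    using that by (auto simp: upto_rec1 simp del: set_upto)
  show ?thesis
    using *[of "x mod 9"] by (simp add: power_mod pos_mod_bound)
qed

lemma mod_eq_intI: "a = c + m * b \<Longrightarrow> 0 \<le> c \<Longrightarrow> c < m \<Longrightarrow> a mod m = (c :: int)"
  by simp

lemma norm_mod: "(u + D * v) mod m = (u mod m + D * (v mod m)) mod (m :: int)"
  by (metis mod_add_eq mod_mod_trivial mod_mult_right_eq)

lemma even_square_mod_8: "even (x :: int) \<longleftrightarrow> x\<^sup>2 mod 8 \<noteq> 1"
proof -
  have "even x \<longleftrightarrow> even (x\<^sup>2 mod 8)"
    by (simp add: dvd_mod_iff)
  then show ?thesis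
    using square_mod_8[of x] by auto
qed

lemma dvd_diff_mult_halve:
  fixes n :: int
  assumes "odd n" "n dvd 2 * a - r * (2 * b)"
  shows "n dvd a - r * b"
proof -
  have "n dvd 2 * (a - r * b)"
    using assms(2) by (simp add: algebra_simps)
  moreover have "coprime n 2"
    using assms(1) by simp
  ultimately show ?thesis
    using coprime_dvd_mult_right_iff by blast
qed

text \<open>
  Thue's lemma yields \<open>x^2 + 57 y^2 = k n\<close> with \<open>1 \<le> k \<le> 15\<close>. Congruences modulo 3, 4, 5, 8 and 9
  leave only \<open>k = 2\<close> and \<open>k = 8\<close>, and in the latter case \<open>x\<close> and \<open>y\<close> can be halved.
\<close>

lemma norm_57_represents:
  fixes n r :: int
  assumes "n > 0" "n mod 12 = 5" "n dvd r\<^sup>2 + 57"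
  shows "\<exists>x y. n dvd x - r * y \<and> x\<^sup>2 + 57 * y\<^sup>2 = 2 * n"
proof -
  obtain j where n: "n = 12 * j + 5"
    using assms(2) mult_div_mod_eq[of 12 n] by metis
  \<comment> \<open>The weight 8 is close to the square root of 57 and gives
    \<open>k < 121 / 8\<close>.\<close>
  obtain x y k where xy: "n dvd x - r * y" "x\<^sup>2 + 57 * y\<^sup>2 = k * n" "k > 0" "8 * k < 8 * 8 + 57"
    using thue_norm[of n 8 57 r] assms by auto
  \<comment> \<open>Modulo 3 the form is a square, hence 0 or 1, while the right-hand side is
    2.\<close>
  have mod_3: "u\<^sup>2 + 57 * v\<^sup>2 \<noteq> (3 * i + 1) * n" for u v i
  proof
    assume *: "u\<^sup>2 + 57 * v\<^sup>2 = (3 * i + 1) * n"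
    have "n mod 3 = n mod 12 mod 3"
      by (simp add: mod_mod_cancel)
    then have "n mod 3 = 2"
      using assms(2) by simp
    moreover have "((3 * i + 1) * n) mod 3 = n mod 3"
    proof -
      have "(3 * i + 1) * n = n + 3 * (i * n)"
        by (simp add: algebra_simps)
      then show ?thesis
        by (simp only: mod_mult_self2)
    qed
    ultimately have "((3 * i + 1) * n) mod 3 = 2"
      by simp
    then show False
      using * norm_mod[of "u\<^sup>2" 57 "v\<^sup>2" 3] square_mod_3[of u] square_mod_3[of v] by auto
  qed
  have not_1: "k \<noteq> 1" "k \<noteq> 4" "k \<noteq> 7" "k \<noteq> 10" "k \<noteq> 13"
    using mod_3[of x y 0] mod_3[of x y 1] mod_3[of x y 2] mod_3[of x y 3] mod_3[of x y 4] xy(2)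
    by auto
  have not_8: "k \<noteq> k'" if "(k' * n) mod 8 = 6" for k'
    using norm_mod[of "x\<^sup>2" 57 "y\<^sup>2" 8] square_mod_8[of x] square_mod_8[of y] xy(2) that by auto
  have not_4: "k \<noteq> k'" if "(k' * n) mod 4 = 3" for k'
    using norm_mod[of "x\<^sup>2" 57 "y\<^sup>2" 4] square_mod_4[of x] square_mod_4[of y] xy(2) that by auto
  have not_mod: "k \<noteq> 6" "k \<noteq> 14" "k \<noteq> 3" "k \<noteq> 11" "k \<noteq> 15"
  proof -
    show "k \<noteq> 6"
      by (rule not_8, rule mod_eq_intI[where b = "9 * j + 3"]) (simp_all add: n)
    show "k \<noteq> 14"
      by (rule not_8, rule mod_eq_intI[where b = "21 * j + 8"]) (simp_all add: n)
    show "k \<noteq> 3"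
      by (rule not_4, rule mod_eq_intI[where b = "9 * j + 3"]) (simp_all add: n)
    show "k \<noteq> 11"
      by (rule not_4, rule mod_eq_intI[where b = "33 * j + 13"]) (simp_all add: n)
    show "k \<noteq> 15"
      by (rule not_4, rule mod_eq_intI[where b = "45 * j + 18"]) (simp_all add: n)
  qed
  have not_12: "k \<noteq> 12"
  proof
    assume k: "k = 12"
    have "(k * n) mod 9 = 6"
      by (rule mod_eq_intI[where b = "16 * j + 6"]) (simp_all add: n k)
    then show False
      using norm_mod[of "x\<^sup>2" 57 "y\<^sup>2" 9] square_mod_9[of x] square_mod_9[of y] xy(2) by auto
  qed
  \<comment> \<open>Both \<open>x\<close> and \<open>y\<close> are divisible by 3, and dividing by 9
    leads to the excluded multiple \<open>k = 1\<close>.\<close>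
  have not_9: "k \<noteq> 9"
  proof
    assume k: "k = 9"
    have "x\<^sup>2 = 3 * (3 * n - 19 * y\<^sup>2)"
      using xy(2) unfolding k by simp
    then have "3 dvd x\<^sup>2"
      by (rule dvdI)
    then have "3 dvd x"
      by (rule prime_dvd_power[rotated]) (simp add: prime_int_numeral_eq)
    then obtain x' where x': "x = 3 * x'"
      by (auto elim: dvdE)
    have "19 * y\<^sup>2 = 3 * (n - x'\<^sup>2)"
      using xy(2) unfolding k x' by (simp add: power_mult_distrib)
    then have "3 dvd 19 * y\<^sup>2"
      by (rule dvdI)
    moreover have "prime (3 :: int)"
      by (simp add: prime_int_numeral_eq)
    ultimately have "3 dvd y\<^sup>2"
      using prime_dvd_multD[of 3 19 "y\<^sup>2"] by auto
    then have "3 dvd y"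
      by (rule prime_dvd_power[rotated]) (simp add: prime_int_numeral_eq)
    then obtain y' where y': "y = 3 * y'"
      by (auto elim: dvdE)
    have "x'\<^sup>2 + 57 * y'\<^sup>2 = (3 * 0 + 1) * n"
      using xy(2) unfolding k x' y' by (simp add: power_mult_distrib)
    then show False
      using mod_3[of x' y' 0] by contradiction
  qed
  \<comment> \<open>-57 is 3 modulo 5, a nonresidue. So 5 divides \<open>x\<close> and
    \<open>y\<close>, hence \<open>n\<close>, and then \<open>r\<close> would be a square root of
    -57 modulo 5.\<close>
  have not_5: "k \<noteq> 5"
  proof
    assume k: "k = 5"
    have "(x\<^sup>2 + 57 * y\<^sup>2) mod 5 = 0"
      using xy(2) unfolding k by simp
    then have "x\<^sup>2 mod 5 = 0" "y\<^sup>2 mod 5 = 0"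
      using norm_mod[of "x\<^sup>2" 57 "y\<^sup>2" 5] square_mod_5[of x] square_mod_5[of y] by auto
    then have "5 dvd x\<^sup>2" "5 dvd y\<^sup>2"
      by (simp_all only: dvd_eq_mod_eq_0)
    moreover have "prime (5 :: int)"
      by (simp add: prime_int_numeral_eq)
    ultimately have "5 dvd x" "5 dvd y"
      using prime_dvd_power by blast+
    then obtain x' y' where "x = 5 * x'" "y = 5 * y'"
      by (auto elim!: dvdE)
    then have "n = 5 * (x'\<^sup>2 + 57 * y'\<^sup>2)"
      using xy(2) unfolding k by (simp add: power_mult_distrib)
    then have "5 dvd n"
      by (rule dvdI)
    then have "5 dvd r\<^sup>2 + 57"
      using assms(3) by (rule dvd_trans)
    then have "(r\<^sup>2 + 57 * 1) mod 5 = 0"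
      by (simp only: mult_1_right dvd_eq_mod_eq_0)
    then show False
      using norm_mod[of "r\<^sup>2" 57 1 5] square_mod_5[of r] by auto
  qed
  have "k \<in> set [1..15]"
    using xy(3,4) by simp
  then consider "k = 2" | "k = 8"
    using not_1 not_mod not_12 not_9 not_5 by (auto simp: upto_rec1 simp del: set_upto)
  then show ?thesis
  proof cases
    case 1
    then show ?thesis using xy by blast
  next
    case 2
    have "(x\<^sup>2 + 57 * y\<^sup>2) mod 8 = 0"
      using xy(2) unfolding 2 by simp
    then have "even x" "even y"
      using norm_mod[of "x\<^sup>2" 57 "y\<^sup>2" 8] square_mod_8[of x] square_mod_8[of y] even_square_mod_8[of x]
        even_square_mod_8[of y] by auto
    then obtain x' y' where xy': "x = 2 * x'" "y = 2 * y'"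
      by (auto elim!: evenE)
    have "odd n"
      using mod_12_imp[of n] assms(2) by simp
    then have "n dvd x' - r * y'"
      using xy(1) unfolding xy' by (rule dvd_diff_mult_halve)
    moreover have "x'\<^sup>2 + 57 * y'\<^sup>2 = 2 * n"
      using xy(2) unfolding 2 xy' by (simp add: power_mult_distrib)
    ultimately show ?thesis
      by blast
  qed
qed

text \<open>
  For 9 and 19, applying Thue's lemma modulo \<open>2n\<close> forces \<open>x\<close> and \<open>y\<close> to have the same parity. This
  excludes the multiples \<open>5n\<close> and \<open>7n\<close> that no congruence rules out.
\<close>

lemma odd_square_root_mod:
  fixes n r D :: int
  assumes "odd n" "odd D" "n dvd r\<^sup>2 + D"
  obtains s where "2 * n dvd s\<^sup>2 + D" "[s = r] (mod n)" "odd s"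
proof -
  define s where "s = (if odd r then r else r + n)"
  have "odd s" "[s = r] (mod n)"
    using assms(1) by (auto simp: s_def cong_def)
  then have "n dvd s\<^sup>2 + D"
    using assms(3) dvd_square_plus_cong by blast
  moreover have "even (s\<^sup>2 + D)"
    using \<open>odd s\<close> assms(2) by simp
  moreover have "coprime 2 n"
    using assms(1) by simp
  ultimately have "2 * n dvd s\<^sup>2 + D"
    by (intro divides_mult)
  then show ?thesis
    using that \<open>odd s\<close> \<open>[s = r] (mod n)\<close> by blast
qed

lemma dvd_diff_mult_cong:
  fixes n r s x y :: int
  assumes "2 * n dvd x - s * y" "[s = r] (mod n)"
  shows "n dvd x - r * y"
proof -
  have "n dvd x - s * y"
    using assms(1) by (rule dvd_mult_right)
  moreover have "n dvd (s - r) * y"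
    using assms(2) by (auto simp: cong_iff_dvd_diff)
  moreover have "x - r * y = (x - s * y) + (s - r) * y"
    by (simp add: algebra_simps)
  ultimately show ?thesis
    by (metis dvd_add)
qed

lemma norm_9_represents:
  fixes n r :: int
  assumes "n > 0" "n mod 12 = 5" "n dvd r\<^sup>2 + 9"
  shows "\<exists>x y. n dvd x - r * y \<and> x\<^sup>2 + 9 * y\<^sup>2 = 2 * n"
proof -
  have odd: "odd n"
    using mod_12_imp[of n] assms(2) by simp
  obtain j where n: "n = 12 * j + 5"
    using assms(2) mult_div_mod_eq[of 12 n] by metis
  obtain s where s: "2 * n dvd s\<^sup>2 + 9" "[s = r] (mod n)"
    using odd_square_root_mod[OF odd _ assms(3)] by auto
  \<comment> \<open>The weight 3 gives \<open>k < 6\<close>, now for multiples of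
    \<open>2 * n\<close>; only 1 and 4 survive the congruences.\<close>
  obtain x y k where xy: "2 * n dvd x - s * y" "x\<^sup>2 + 9 * y\<^sup>2 = k * (2 * n)" "k > 0" "3 * k < 3 * 3 + 9"
    using thue_norm[of "2 * n" 3 9 s] assms s by auto
  have dvd: "n dvd x - r * y"
    using xy(1) s(2) by (rule dvd_diff_mult_cong)
  have not_3: "k \<noteq> k'" if "(k' * (2 * n)) mod 3 = 2" for k'
    using norm_mod[of "x\<^sup>2" 9 "y\<^sup>2" 3] square_mod_3[of x] square_mod_3[of y] xy(2) that by auto
  have not_9: "k \<noteq> k'" if "(k' * (2 * n)) mod 9 = 3" for k'
    using norm_mod[of "x\<^sup>2" 9 "y\<^sup>2" 9] square_mod_9[of x] square_mod_9[of y] xy(2) that by auto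
  have not_mod: "k \<noteq> 2" "k \<noteq> 5" "k \<noteq> 3"
  proof -
    show "k \<noteq> 2"
      by (rule not_3, rule mod_eq_intI[where b = "16 * j + 6"]) (simp_all add: n)
    show "k \<noteq> 5"
      by (rule not_3, rule mod_eq_intI[where b = "40 * j + 16"]) (simp_all add: n)
    show "k \<noteq> 3"
      by (rule not_9, rule mod_eq_intI[where b = "8 * j + 3"]) (simp_all add: n)
  qed
  have "k \<in> set [1..5]"
    using xy(3,4) by simp
  then consider "k = 1" | "k = 4"
    using not_mod by (auto simp: upto_rec1 simp del: set_upto)
  then show ?thesis
  proof cases
    case 1
    then show ?thesis using xy dvd by auto
  next
    case 2
    have "(x\<^sup>2 + 9 * y\<^sup>2) mod 8 = 0"
      using xy(2) unfolding 2 by simp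
    then have "even x" "even y"
      using norm_mod[of "x\<^sup>2" 9 "y\<^sup>2" 8] square_mod_8[of x] square_mod_8[of y] even_square_mod_8[of x]
        even_square_mod_8[of y] by auto
    then obtain x' y' where xy': "x = 2 * x'" "y = 2 * y'"
      by (auto elim!: evenE)
    have "n dvd x' - r * y'"
      using odd dvd unfolding xy' by (rule dvd_diff_mult_halve)
    moreover have "x'\<^sup>2 + 9 * y'\<^sup>2 = 2 * n"
      using xy(2) unfolding 2 xy' by (simp add: power_mult_distrib)
    ultimately show ?thesis
      by blast
  qed
qed

lemma norm_19_represents:
  fixes n r :: int
  assumes "n > 0" "n mod 12 = 5" "n dvd r\<^sup>2 + 19"
  shows "\<exists>x y. n dvd x - r * y \<and> x\<^sup>2 + 19 * y\<^sup>2 = 4 * n"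
proof -
  have odd: "odd n"
    using mod_12_imp[of n] assms(2) by simp
  obtain j where n: "n = 12 * j + 5"
    using assms(2) mult_div_mod_eq[of 12 n] by metis
  obtain s where s: "2 * n dvd s\<^sup>2 + 19" "[s = r] (mod n)"
    using odd_square_root_mod[OF odd _ assms(3)] by auto
  \<comment> \<open>The weight 4 gives \<open>k < 35 / 4\<close>. The target \<open>4 * n\<close> is
    the case \<open>k = 2\<close>, and \<open>k = 8\<close> reduces to it by halving.\<close>
  obtain x y k where xy: "2 * n dvd x - s * y" "x\<^sup>2 + 19 * y\<^sup>2 = k * (2 * n)" "k > 0" "4 * k < 4 * 4 + 19"
    using thue_norm[of "2 * n" 4 19 s] assms s by auto
  have dvd: "n dvd x - r * y"
    using xy(1) s(2) by (rule dvd_diff_mult_cong)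
  have not_9: "k \<noteq> k'" if "(k' * (2 * n)) mod 9 = 6" for k'
    using norm_mod[of "x\<^sup>2" 19 "y\<^sup>2" 9] square_mod_9[of x] square_mod_9[of y] xy(2) that by auto
  have norm_8: "(u\<^sup>2 + 19 * v\<^sup>2) mod 8 \<noteq> 2" "(u\<^sup>2 + 19 * v\<^sup>2) mod 8 \<noteq> 6" for u v :: int
    using norm_mod[of "u\<^sup>2" 19 "v\<^sup>2" 8] square_mod_8[of u] square_mod_8[of v] by auto
  have not_8: "k \<noteq> k'" if "(k' * (2 * n)) mod 8 = 2 \<or> (k' * (2 * n)) mod 8 = 6" for k'
    using norm_8[of x y] xy(2) that by auto
  have not_mod: "k \<noteq> 6" "k \<noteq> 1" "k \<noteq> 3" "k \<noteq> 5" "k \<noteq> 7"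
  proof -
    show "k \<noteq> 6"
      by (rule not_9, rule mod_eq_intI[where b = "16 * j + 6"]) (simp_all add: n)
    show "k \<noteq> 1"
      by (rule not_8, rule disjI1, rule mod_eq_intI[where b = "3 * j + 1"]) (simp_all add: n)
    show "k \<noteq> 3"
      by (rule not_8, rule disjI2, rule mod_eq_intI[where b = "9 * j + 3"]) (simp_all add: n)
    show "k \<noteq> 5"
      by (rule not_8, rule disjI1, rule mod_eq_intI[where b = "15 * j + 6"]) (simp_all add: n)
    show "k \<noteq> 7"
      by (rule not_8, rule disjI2, rule mod_eq_intI[where b = "21 * j + 8"]) (simp_all add: n)
  qed
  have halve: "\<exists>x' y'. x = 2 * x' \<and> y = 2 * y' \<and> n dvd x' - r * y'" if "8 dvd k * (2 * n)"
  proof -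
    have "(x\<^sup>2 + 19 * y\<^sup>2) mod 8 = 0"
      using xy(2) that by simp
    then have "even x" "even y"
      using norm_mod[of "x\<^sup>2" 19 "y\<^sup>2" 8] square_mod_8[of x] square_mod_8[of y] even_square_mod_8[of x]
        even_square_mod_8[of y] by auto
    then obtain x' y' where xy': "x = 2 * x'" "y = 2 * y'"
      by (auto elim!: evenE)
    have "n dvd x' - r * y'"
      using odd dvd unfolding xy' by (rule dvd_diff_mult_halve)
    then show ?thesis
      using xy' by blast
  qed
  \<comment> \<open>Halving would produce the value \<open>2 * n\<close>, which is 2 modulo 8 and
    not taken by the form.\<close>
  have not_4: "k \<noteq> 4"
  proof
    assume k: "k = 4"
    then obtain x' y' where xy': "x = 2 * x'" "y = 2 * y'"
      using halve by auto
    have "x'\<^sup>2 + 19 * y'\<^sup>2 = 2 * n"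
      using xy(2) unfolding k xy' by (simp add: power_mult_distrib)
    moreover have "(2 * n) mod 8 = 2"
      by (rule mod_eq_intI[where b = "3 * j + 1"]) (simp_all add: n)
    ultimately show False
      using norm_8 by metis
  qed
  have "k \<in> set [1..8]"
    using xy(3,4) by simp
  then consider "k = 2" | "k = 8"
    using not_mod not_4 by (auto simp: upto_rec1 simp del: set_upto)
  then show ?thesis
  proof cases
    case 1
    then show ?thesis using xy dvd by auto
  next
    case 2
    then obtain x' y' where xy': "x = 2 * x'" "y = 2 * y'" "n dvd x' - r * y'"
      using halve by auto
    moreover have "x'\<^sup>2 + 19 * y'\<^sup>2 = 4 * n"
      using xy(2) unfolding 2 xy' by (simp add: power_mult_distrib)
    ultimately show ?thesis
      by blast
  qed
qed

section \<open>Primitive representations and square roots\<close>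

definition norm_reps :: "nat \<Rightarrow> nat \<Rightarrow> nat \<Rightarrow> (nat \<times> nat) set" where
  "norm_reps D m n = {(a, b). a > 0 \<and> b > 0 \<and> a\<^sup>2 + D * b\<^sup>2 = m * n}"

text \<open>Primitivity is expressed through \<open>b\<close> and \<open>n\<close> because the
  quotient of \<open>a\<close> by \<open>b\<close> modulo \<open>n\<close> is the square root of
  \<open>- D\<close> attached to the pair.\<close>

definition prim_reps :: "nat \<Rightarrow> nat \<Rightarrow> nat \<Rightarrow> (nat \<times> nat) set" where
  "prim_reps D m n = {(a, b) \<in> norm_reps D m n. coprime b n}"

lemma finite_norm_reps:
  assumes "D > 0"
  shows "finite (norm_reps D m n)"
proof (rule finite_subset)
  show "norm_reps D m n \<subseteq> {..m * n} \<times> {..m * n}"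
  proof
    fix p assume "p \<in> norm_reps D m n"
    then obtain a b where p: "p = (a, b)" and eq: "a\<^sup>2 + D * b\<^sup>2 = m * n"
      by (auto simp: norm_reps_def)
    have "b \<le> b\<^sup>2" "b\<^sup>2 \<le> D * b\<^sup>2"
      using assms by (simp_all add: power2_eq_square)
    then have "b \<le> D * b\<^sup>2"
      by (rule order_trans)
    moreover have "a \<le> a\<^sup>2"
      by (simp add: power2_eq_square)
    ultimately show "p \<in> {..m * n} \<times> {..m * n}"
      using eq unfolding p by simp
  qed
qed simp

text \<open>Allows the correspondence between pairs and roots to be given as the divisibility
  \<open>n dvd a - r * b\<close> instead of an explicit function.\<close>

lemma card_eq_relation:
  assumes "\<And>x. x \<in> A \<Longrightarrow> \<exists>!y. y \<in> B \<and> R x y" "\<And>y. y \<in> B \<Longrightarrow> \<exists>!x. x \<in> A \<and> R x y"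
  shows "card A = card B"
proof -
  define f where "f x = (THE y. y \<in> B \<and> R x y)" for x
  have f: "f x \<in> B \<and> R x (f x)" if "x \<in> A" for x
    using theI'[OF assms(1)[OF that]] by (simp add: f_def)
  have "bij_betw f A B"
    unfolding bij_betw_def
  proof
    show "inj_on f A"
      by (rule inj_onI) (metis f assms(2))
    have "y \<in> f ` A" if y: "y \<in> B" for y
    proof -
      obtain x where x: "x \<in> A" "R x y"
        using assms(2)[OF y] by blast
      then have "y = f x"
        using f[OF x(1)] assms(1)[OF x(1)] y by blast
      then show ?thesis
        using x by blast
    qed
    then show "f ` A = B"
      using f by blast
  qed
  then show ?thesis
    by (rule bij_betw_same_card)
qed

text \<open>Brahmagupta's identity writes \<open>m^2 * n^2\<close> as a square plus
  \<open>D * (a * d - b * c)^2\<close>. The difference is a multiple of \<open>n\<close>, so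
  \<open>D > m^2\<close> forces it to be 0; proportional pairs with equal norm and positive
  \<open>b\<close>, \<open>d\<close> coincide.\<close>

lemma norm_rep_unique:
  fixes a b c d D m n r :: int
  assumes "D > m\<^sup>2" "m > 0" "n > 0" "b > 0" "d > 0"
    and "a\<^sup>2 + D * b\<^sup>2 = m * n" "c\<^sup>2 + D * d\<^sup>2 = m * n"
    and "n dvd a - r * b" "n dvd c - r * d"
  shows "a = c \<and> b = d"
proof -
  have "n dvd (a - r * b) * d - (c - r * d) * b"
    using dvd_mult2[OF assms(8)] dvd_mult2[OF assms(9)] by (rule dvd_diff)
  then have dvd: "n dvd a * d - b * c"
    by (simp add: algebra_simps)
  have "(a * c + D * b * d)\<^sup>2 + D * (a * d - b * c)\<^sup>2 = (a\<^sup>2 + D * b\<^sup>2) * (c\<^sup>2 + D * d\<^sup>2)"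
    by (simp add: power2_eq_square algebra_simps)
  also have "\<dots> = m\<^sup>2 * n\<^sup>2"
    unfolding assms by (simp add: power2_eq_square algebra_simps)
  finally have "D * (a * d - b * c)\<^sup>2 \<le> m\<^sup>2 * n\<^sup>2"
    by (smt (verit) zero_le_power2)
  have D: "D > 0"
    using assms(1) by (smt (verit) zero_le_power2)
  have "a * d = b * c"
  proof (rule ccontr)
    assume "a * d \<noteq> b * c"
    then have "n \<le> \<bar>a * d - b * c\<bar>"
      using dvd dvd_imp_le_int[of "a * d - b * c" n] assms(3) by auto
    then have "n\<^sup>2 \<le> (a * d - b * c)\<^sup>2"
      using assms(3) by (metis abs_le_square_iff abs_of_pos)
    then have "D * n\<^sup>2 \<le> D * (a * d - b * c)\<^sup>2"
      using D by simp
    then have "D * n\<^sup>2 \<le> m\<^sup>2 * n\<^sup>2"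
      using \<open>D * (a * d - b * c)\<^sup>2 \<le> m\<^sup>2 * n\<^sup>2\<close> by simp
    then show False
      using assms(1,3) by simp
  qed
  then have "(a * d)\<^sup>2 = (b * c)\<^sup>2"
    by simp
  then have "d\<^sup>2 * (a\<^sup>2 + D * b\<^sup>2) = b\<^sup>2 * (c\<^sup>2 + D * d\<^sup>2)"
    by (simp add: power_mult_distrib algebra_simps)
  then have "d\<^sup>2 = b\<^sup>2"
    unfolding assms using assms(2,3) by simp
  then have "d = b"
    using assms(4,5) by (simp add: power2_eq_iff)
  then show ?thesis
    using \<open>a * d = b * c\<close> assms(4) by simp
qed

text \<open>Substituting \<open>x = r * y + n * s\<close> and cancelling \<open>n\<close> expresses
  \<open>m\<close> through \<open>y\<close> and \<open>n\<close>, so a common divisor of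
  \<open>y\<close> and \<open>n\<close> divides \<open>m\<close>, which is coprime to
  \<open>n\<close>.\<close>

lemma norm_rep_coprime:
  fixes x y D m n r :: int
  assumes "n > 0" "coprime m n" "n dvd r\<^sup>2 + D" "n dvd x - r * y" "x\<^sup>2 + D * y\<^sup>2 = m * n"
  shows "coprime y n"
proof -
  obtain w where w: "r\<^sup>2 + D = n * w"
    using assms(3) by (auto elim: dvdE)
  obtain s where "x - r * y = n * s"
    using assms(4) by (auto elim: dvdE)
  then have x: "x = r * y + n * s"
    by simp
  have "m * n = (r\<^sup>2 + D) * y\<^sup>2 + n * (2 * r * s * y + s\<^sup>2 * n)"
    unfolding assms(5)[symmetric] x by (simp add: power2_eq_square algebra_simps)
  also have "\<dots> = (w * y\<^sup>2 + 2 * r * s * y + s\<^sup>2 * n) * n"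
    unfolding w by (simp add: algebra_simps)
  finally have m: "m = w * y\<^sup>2 + 2 * r * s * y + s\<^sup>2 * n"
    using assms(1) by simp
  show ?thesis
  proof (rule coprimeI)
    fix c assume c: "c dvd y" "c dvd n"
    then have "c dvd m"
      unfolding m by (intro dvd_add dvd_mult) (auto simp: power2_eq_square)
    then show "is_unit c"
      using c assms(2) by (metis coprime_common_divisor)
  qed
qed

text \<open>Up to a common sign, each root belongs to exactly one pair with \<open>a\<close> of
  either sign: \<open>ex\<close> provides it and \<open>norm_rep_unique\<close> makes it unique. The
  factor 2 is the sign of \<open>a\<close>, which is nonzero by \<open>nz\<close>.\<close>

lemma card_prim_reps:
  fixes D m n :: nat
  assumes "n > 1" "m > 0" "coprime m n" "D > m\<^sup>2"
    and nz: "\<And>b. D * b\<^sup>2 \<noteq> m * n"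
    and ex: "\<And>r. int n dvd r\<^sup>2 + int D \<Longrightarrow>
      \<exists>x y. int n dvd x - r * y \<and> x\<^sup>2 + int D * y\<^sup>2 = int m * int n"
  shows "2 * card (prim_reps D m n) = card (neg_roots (int D) (int n))"
proof -
  define T where "T = {(a :: int, b :: int). b > 0 \<and> a\<^sup>2 + int D * b\<^sup>2 = int m * int n \<and> coprime b (int n)}"
  have cop: "coprime (int m) (int n)"
    using assms(3) by simp
  have Dm: "int D > (int m)\<^sup>2"
    using assms(4) by (metis of_nat_less_iff of_nat_power)
  have D0: "D > 0"
    using assms(4) by simp
  define P where "P = prim_reps D m n"
  have finP: "finite P"
    using finite_norm_reps[OF D0] by (auto simp: P_def prim_reps_def intro: finite_subset)
  let ?f = "\<lambda>(a, b). (int a, int b)" and ?g = "\<lambda>(a, b). (- int a, int b)"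
  have sq: "a\<^sup>2 + D * b\<^sup>2 = m * n \<longleftrightarrow> (int a)\<^sup>2 + int D * (int b)\<^sup>2 = int m * int n" for a b
    by (metis of_nat_add of_nat_eq_iff of_nat_mult of_nat_power)
  have "T = ?f ` P \<union> ?g ` P"
  proof (intro equalityI subsetI)
    fix p assume "p \<in> T"
    then obtain a b where p: "p = (a, b)" and b: "b > 0" "a\<^sup>2 + int D * b\<^sup>2 = int m * int n" "coprime b (int n)"
      by (auto simp: T_def)
    have ab: "int (nat b) = b" "int (nat \<bar>a\<bar>) = \<bar>a\<bar>"
      using b by auto
    have "a \<noteq> 0"
    proof
      assume "a = 0"
      then have "int (D * (nat b)\<^sup>2) = int (m * n)"
        using b(2) ab by simp
      then show False
        using nz of_nat_eq_iff by blast
    qed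
    then have "(nat \<bar>a\<bar>, nat b) \<in> P"
      using b unfolding P_def prim_reps_def norm_reps_def
      by (auto simp: sq ab simp flip: coprime_int_iff)
    moreover have "p = ?f (nat \<bar>a\<bar>, nat b) \<or> p = ?g (nat \<bar>a\<bar>, nat b)"
      using b unfolding p by auto
    ultimately show "p \<in> ?f ` P \<union> ?g ` P"
      by blast
  qed (auto simp: T_def P_def prim_reps_def norm_reps_def sq)
  moreover have "?f ` P \<inter> ?g ` P = {}"
    by (auto simp: P_def prim_reps_def norm_reps_def)
  moreover have "card (?f ` P) = card P" "card (?g ` P) = card P"
    by (auto intro!: card_image inj_onI)
  ultimately have "card T = 2 * card P"
    using finP by (simp add: card_Un_disjoint)
  moreover have "card T = card (neg_roots (int D) (int n))"
  proof (rule card_eq_relation[where R = "\<lambda>(a, b) r. int n dvd a - r * b"])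
    fix p assume "p \<in> T"
    then obtain a b where p: "p = (a, b)" and b: "b > 0" "a\<^sup>2 + int D * b\<^sup>2 = int m * int n" "coprime b (int n)"
      by (auto simp: T_def)
    obtain c where "[b * c = 1] (mod int n)"
      using b(3) cong_solve_coprime_int by blast
    then obtain e where e: "b * c - 1 = int n * e"
      by (auto simp: cong_iff_dvd_diff elim: dvdE)
    \<comment> \<open>\<open>c\<close> inverts \<open>b\<close>, so this is the quotient of
      \<open>a\<close> by \<open>b\<close> modulo \<open>n\<close>.\<close>
    define r where "r = (a * c) mod int n"
    have "[r = a * c] (mod int n)"
      by (simp add: r_def cong_def)
    then obtain k where k: "r - a * c = int n * k"
      by (auto simp: cong_iff_dvd_diff elim: dvdE)
    have "a - r * b = - a * (b * c - 1) - (r - a * c) * b"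
      by (simp add: algebra_simps)
    also have "\<dots> = int n * (- a * e - k * b)"
      unfolding e k by (simp add: algebra_simps)
    finally have dvd: "int n dvd a - r * b"
      by (rule dvdI)
    have "b\<^sup>2 * (r\<^sup>2 + int D) = (a\<^sup>2 + int D * b\<^sup>2) - (a - r * b) * (a + r * b)"
      by (simp add: power2_eq_square algebra_simps)
    also have "int n dvd \<dots>"
      unfolding b(2) using dvd_triv_right dvd_mult2[OF dvd] by (rule dvd_diff)
    finally have "int n dvd r\<^sup>2 + int D"
      using b(3) by (metis coprime_commute coprime_dvd_mult_right_iff coprime_power_right_iff)
    then have root: "r \<in> neg_roots (int D) (int n)"
      using assms(1) by (simp add: neg_roots_def r_def)
    show "\<exists>!r. r \<in> neg_roots (int D) (int n) \<and> (case p of (a, b) \<Rightarrow> \<lambda>r. int n dvd a - r * b) r"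
    proof (rule ex1I)
      show "r \<in> neg_roots (int D) (int n) \<and> (case p of (a, b) \<Rightarrow> \<lambda>r. int n dvd a - r * b) r"
        using dvd root by (simp add: p)
      fix s assume s: "s \<in> neg_roots (int D) (int n) \<and> (case p of (a, b) \<Rightarrow> \<lambda>r. int n dvd a - r * b) s"
      then have "int n dvd a - s * b"
        by (simp add: p)
      with dvd have "int n dvd (a - r * b) - (a - s * b)"
        by (rule dvd_diff)
      then have "int n dvd (s - r) * b"
        by (simp add: algebra_simps)
      then have "int n dvd s - r"
        using b(3) by (metis coprime_commute coprime_dvd_mult_left_iff)
      then have "[s = r] (mod int n)"
        by (simp add: cong_iff_dvd_diff)
      then show "s = r"
        using s root by (auto simp: neg_roots_def intro: cong_less_imp_eq_int)
    qed
  next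
    fix r assume "r \<in> neg_roots (int D) (int n)"
    then have r: "int n dvd r\<^sup>2 + int D"
      by (simp add: neg_roots_def)
    obtain x y where xy: "int n dvd x - r * y" "x\<^sup>2 + int D * y\<^sup>2 = int m * int n"
      using ex[OF r] by blast
    have cy: "coprime y (int n)"
      using assms(1) by (intro norm_rep_coprime[OF _ cop r xy]) auto
    then have "y \<noteq> 0"
      using assms(1) by auto
    have "\<exists>p. p \<in> T \<and> (case p of (a, b) \<Rightarrow> \<lambda>r. int n dvd a - r * b) r"
    proof (cases "y > 0")
      case True
      then show ?thesis
        using xy cy by (intro exI[of _ "(x, y)"]) (auto simp: T_def)
    next
      case False
      \<comment> \<open>Negating both coordinates keeps the root and makes the second coordinate
        positive.\<close>
      have "int n dvd - (x - r * y)"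
        using xy(1) by (simp only: dvd_minus_iff)
      then have "int n dvd (- x) - r * (- y)"
        by (simp add: algebra_simps)
      then show ?thesis
        using xy cy False \<open>y \<noteq> 0\<close> by (intro exI[of _ "(- x, - y)"]) (auto simp: T_def)
    qed
    moreover have "p = q" if "p \<in> T \<and> (case p of (a, b) \<Rightarrow> \<lambda>r. int n dvd a - r * b) r"
      "q \<in> T \<and> (case q of (a, b) \<Rightarrow> \<lambda>r. int n dvd a - r * b) r" for p q
    proof -
      obtain a b c d where pq: "p = (a, b)" "q = (c, d)"
        by (metis surj_pair)
      have "a = c \<and> b = d"
        using that assms(1,2) Dm unfolding pq T_def
        by (intro norm_rep_unique[of "int m" "int D" "int n" b d a c r]) auto
      then show ?thesis
        by (simp add: pq)
    qed
    ultimately show "\<exists>!p. p \<in> T \<and> (case p of (a, b) \<Rightarrow> \<lambda>r. int n dvd a - r * b) r"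
      by blast
  qed
  ultimately show ?thesis
    by (simp add: P_def)
qed

section \<open>From primitive to all representations\<close>

lemma norm_rep_gcd_square_dvd:
  fixes a b D m N :: nat
  assumes "a\<^sup>2 + D * b\<^sup>2 = m * N" "coprime m N" "c dvd a" "c dvd b" "c dvd N"
  shows "c\<^sup>2 dvd N"
proof -
  have "c\<^sup>2 dvd m * N"
    unfolding assms(1)[symmetric] using assms(3,4) by (intro dvd_add dvd_mult) auto
  moreover have "coprime (c\<^sup>2) m"
    using assms(2,5) by (metis coprime_commute coprime_divisors coprime_power_left_iff dvd_refl)
  ultimately show ?thesis
    by (simp add: coprime_dvd_mult_right_iff)
qed

text \<open>The factor to divide out is \<open>g = gcd (gcd a b) N\<close>. If a prime still divided
  both \<open>b div g\<close> and \<open>N div g^2\<close>, the equation would make it divide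
  \<open>a div g\<close> too, contradicting the choice of \<open>g\<close>.\<close>

lemma norm_reps_decompose:
  assumes "coprime m N" "N > 0"
  shows "norm_reps D m N
    = (\<Union>g\<in>{g. g\<^sup>2 dvd N}. (\<lambda>(a, b). (g * a, g * b)) ` prim_reps D m (N div g\<^sup>2))"
proof (intro equalityI subsetI)
  fix p assume "p \<in> norm_reps D m N"
  then obtain a b where p: "p = (a, b)" and ab: "a > 0" "b > 0" "a\<^sup>2 + D * b\<^sup>2 = m * N"
    by (auto simp: norm_reps_def)
  define g where "g = gcd (gcd a b) N"
  have g: "g dvd a" "g dvd b" "g dvd N"
    unfolding g_def by (meson dvd_trans gcd_dvd1 gcd_dvd2)+
  have g0: "g > 0"
    using g(1) ab(1) by (auto intro: dvd_pos_nat)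
  have g2: "g\<^sup>2 dvd N"
    using ab(3) assms(1) g by (rule norm_rep_gcd_square_dvd)
  obtain a' b' n where a': "a = g * a'" and b': "b = g * b'" and n: "N = g\<^sup>2 * n"
    using g(1,2) g2 by (auto elim!: dvdE)
  have "g\<^sup>2 * (a'\<^sup>2 + D * b'\<^sup>2) = g\<^sup>2 * (m * n)"
  proof -
    have "g\<^sup>2 * (a'\<^sup>2 + D * b'\<^sup>2) = a\<^sup>2 + D * b\<^sup>2"
      unfolding a' b' by (simp add: power_mult_distrib algebra_simps)
    also have "\<dots> = g\<^sup>2 * (m * n)"
      unfolding ab(3) n by simp
    finally show ?thesis .
  qed
  then have eq: "a'\<^sup>2 + D * b'\<^sup>2 = m * n"
    using g0 by (simp only: nat_mult_eq_cancel1 zero_less_power)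
  have "coprime b' n"
  proof (rule ccontr)
    assume "\<not> coprime b' n"
    then have "gcd b' n \<noteq> 1"
      by (simp only: coprime_iff_gcd_eq_1 not_False_eq_True)
    then obtain q where q: "prime q" "q dvd gcd b' n"
      using prime_factor_nat by blast
    then have qb: "q dvd b'" "q dvd n"
      by auto
    then have "q dvd D * b'\<^sup>2" "q dvd m * n"
      by (auto simp: power2_eq_square)
    then have "q dvd a'\<^sup>2"
      unfolding eq[symmetric] by (simp add: dvd_add_left_iff)
    then have "q dvd a'"
      by (rule prime_dvd_power[OF q(1)])
    then have "g * q dvd gcd (gcd a b) N"
      using qb unfolding a' b' n power2_eq_square by (intro gcd_greatest) (auto simp: mult.assoc intro: dvd_mult)
    then have "g * q dvd g"
      by (simp add: g_def)
    then show False
      using g0 q(1) by auto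
  qed
  moreover have "N div g\<^sup>2 = n"
    using n g0 by simp
  ultimately have "(a', b') \<in> prim_reps D m (N div g\<^sup>2)"
    using eq ab(1,2) unfolding prim_reps_def norm_reps_def a' b' by auto
  then have "p \<in> (\<lambda>(a, b). (g * a, g * b)) ` prim_reps D m (N div g\<^sup>2)"
    unfolding p a' b' by force
  then show "p \<in> (\<Union>g\<in>{g. g\<^sup>2 dvd N}. (\<lambda>(a, b). (g * a, g * b)) ` prim_reps D m (N div g\<^sup>2))"
    using g2 by blast
next
  fix p assume "p \<in> (\<Union>g\<in>{g. g\<^sup>2 dvd N}. (\<lambda>(a, b). (g * a, g * b)) ` prim_reps D m (N div g\<^sup>2))"
  then obtain g a b where g2: "g\<^sup>2 dvd N" and p: "p = (g * a, g * b)"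
    and ab: "(a, b) \<in> prim_reps D m (N div g\<^sup>2)"
    by auto
  obtain n where n: "N = g\<^sup>2 * n"
    using g2 by (auto elim: dvdE)
  have g0: "g > 0"
    using n assms(2) by (cases "g = 0") auto
  have "a\<^sup>2 + D * b\<^sup>2 = m * n" "a > 0" "b > 0"
    using ab n g0 by (auto simp: prim_reps_def norm_reps_def)
  moreover have "(g * a)\<^sup>2 + D * (g * b)\<^sup>2 = g\<^sup>2 * (a\<^sup>2 + D * b\<^sup>2)"
    by (simp add: power_mult_distrib algebra_simps)
  ultimately show "p \<in> norm_reps D m N"
    using g0 unfolding p n by (simp add: norm_reps_def)
qed

text \<open>The scaling factor can be recovered from the scaled pair, so the union over
  \<open>g\<close> is disjoint.\<close>

lemma prim_reps_gcd:
  assumes "coprime m N" "N > 0" "g\<^sup>2 dvd N" "(a, b) \<in> prim_reps D m (N div g\<^sup>2)"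
  shows "gcd (gcd (g * a) (g * b)) N = g"
proof -
  obtain n where n: "N = g\<^sup>2 * n"
    using assms(3) by (auto elim: dvdE)
  have g0: "g > 0"
    using n assms(2) by (cases "g = 0") auto
  have ab: "a\<^sup>2 + D * b\<^sup>2 = m * n" "coprime b n"
    using assms(4) n g0 by (auto simp: prim_reps_def norm_reps_def)
  have "coprime (gcd a b) (g * n)"
  proof (rule ccontr)
    assume "\<not> coprime (gcd a b) (g * n)"
    then have "gcd (gcd a b) (g * n) \<noteq> 1"
      by (simp only: coprime_iff_gcd_eq_1 not_False_eq_True)
    then obtain q where q: "prime q" "q dvd gcd (gcd a b) (g * n)"
      using prime_factor_nat by blast
    then have qs: "q dvd a" "q dvd b" "q dvd g * n"
      by auto
    then have "q dvd N"
      unfolding n by (simp add: power2_eq_square mult.assoc)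
    moreover have "q dvd m * n"
      unfolding ab(1)[symmetric] using qs by (intro dvd_add dvd_mult) (auto simp: power2_eq_square)
    ultimately have "q dvd n"
      using assms(1) q(1) by (metis coprime_common_divisor_nat not_prime_1 nat_dvd_1_iff_1 prime_dvd_mult_iff)
    then show False
      using qs(2) ab(2) q(1) by (metis coprime_common_divisor_nat not_prime_1)
  qed
  then have "gcd (gcd a b) (g * n) = 1"
    by (simp only: coprime_iff_gcd_eq_1 not_False_eq_True)
  moreover have "gcd (gcd (g * a) (g * b)) N = g * gcd (gcd a b) (g * n)"
    unfolding n power2_eq_square mult.assoc gcd_mult_distrib_nat[symmetric] ..
  ultimately show ?thesis
    by simp
qed

lemma finite_prim_reps: "D > 0 \<Longrightarrow> finite (prim_reps D m n)"
  by (rule finite_subset[OF _ finite_norm_reps[of D m n]]) (auto simp: prim_reps_def)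

lemma card_norm_reps:
  assumes "coprime m N" "N > 0" "D > 0"
  shows "card (norm_reps D m N) = (\<Sum>g | g\<^sup>2 dvd N. card (prim_reps D m (N div g\<^sup>2)))"
proof -
  let ?f = "\<lambda>g (a, b). (g * a, g * b)"
  have fin: "finite {g. g\<^sup>2 dvd N}"
  proof (rule finite_subset)
    show "{g. g\<^sup>2 dvd N} \<subseteq> {..N}"
      using assms(2) by (auto simp: power2_eq_square dest!: dvd_imp_le intro: order_trans[OF le_square])
  qed simp
  have gcd_image: "gcd (gcd (fst p) (snd p)) N = g"
    if "g\<^sup>2 dvd N" "p \<in> ?f g ` prim_reps D m (N div g\<^sup>2)" for g p
    using that(2) prim_reps_gcd[OF assms(1,2) that(1)] by auto
  have "card (norm_reps D m N) = (\<Sum>g | g\<^sup>2 dvd N. card (?f g ` prim_reps D m (N div g\<^sup>2)))"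
    unfolding norm_reps_decompose[OF assms(1,2)]
  proof (rule card_UN_disjoint[OF fin])
    show "\<forall>g\<in>{g. g\<^sup>2 dvd N}. finite (?f g ` prim_reps D m (N div g\<^sup>2))"
      using finite_prim_reps[OF assms(3)] by simp
    show "\<forall>g\<in>{g. g\<^sup>2 dvd N}. \<forall>h\<in>{g. g\<^sup>2 dvd N}. g \<noteq> h \<longrightarrow>
        ?f g ` prim_reps D m (N div g\<^sup>2) \<inter> ?f h ` prim_reps D m (N div h\<^sup>2) = {}"
    proof (intro ballI impI equals0I)
      fix g h p assume gh: "g \<in> {g. g\<^sup>2 dvd N}" "h \<in> {g. g\<^sup>2 dvd N}" "g \<noteq> h"
        and p: "p \<in> ?f g ` prim_reps D m (N div g\<^sup>2) \<inter> ?f h ` prim_reps D m (N div h\<^sup>2)"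
      have "gcd (gcd (fst p) (snd p)) N = g" "gcd (gcd (fst p) (snd p)) N = h"
        using p gh by (blast intro: gcd_image)+
      then show False
        using gh(3) by simp
    qed
  qed
  also have "\<dots> = (\<Sum>g | g\<^sup>2 dvd N. card (prim_reps D m (N div g\<^sup>2)))"
  proof (rule sum.cong[OF refl])
    fix g assume "g \<in> {g. g\<^sup>2 dvd N}"
    then have "g \<noteq> 0"
      using assms(2) by (cases "g = 0") auto
    then show "card (?f g ` prim_reps D m (N div g\<^sup>2)) = card (prim_reps D m (N div g\<^sup>2))"
      by (intro card_image inj_onI) auto
  qed
  finally show ?thesis .
qed

text \<open>Each count is half a number of square roots, and the total of the latter is divisible by
  4. The multipliers 2, 4, 2 satisfy \<open>m^2 < D\<close>, as uniqueness requires.\<close>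

lemma even_card_prim_reps:
  fixes n :: nat
  assumes "n mod 12 = 5"
  shows "even (card (prim_reps 9 2 n) + card (prim_reps 19 4 n) + card (prim_reps 57 2 n))"
proof -
  have n1: "n > 1"
    using assms by (cases "n = 0"; cases "n = 1") auto
  have m: "int n mod 12 = 5"
    using assms by (metis of_nat_mod of_nat_numeral)
  have odd: "odd n"
    using mod_12_imp(1)[of "int n"] m by simp
  then have c2: "coprime 2 n"
    by simp
  have "(4 :: nat) = 2 * 2"
    by simp
  then have c4: "coprime 4 n"
    using c2 by (simp only: coprime_mult_left_iff)
  \<comment> \<open>Residues modulo 3 show that no representation has first coordinate 0.\<close>
  have m3: "n mod 3 = 2"
    using assms mod_mod_cancel[of 3 12 n] by simp
  have sq: "b\<^sup>2 mod 3 = 0 \<or> b\<^sup>2 mod 3 = 1" for b :: nat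
  proof -
    have "int (b\<^sup>2 mod 3) = (int b)\<^sup>2 mod 3"
      by (simp add: zmod_int)
    then have "int (b\<^sup>2 mod 3) = 0 \<or> int (b\<^sup>2 mod 3) = 1"
      using square_mod_3[of "int b"] by simp
    then show ?thesis
      by linarith
  qed
  have n3: "2 * n mod 3 = 1" "4 * n mod 3 = 2"
    by (subst mod_mult_right_eq[symmetric], simp add: m3)+
  have b3: "9 * b\<^sup>2 mod 3 = 0" "57 * b\<^sup>2 mod 3 = 0" "19 * b\<^sup>2 mod 3 = b\<^sup>2 mod 3" for b :: nat
    by (subst mod_mult_left_eq[symmetric], simp)+
  have "(2 :: nat) \<noteq> 0" "(2 :: nat) \<noteq> 1"
    by simp_all
  then have nz: "9 * b\<^sup>2 \<noteq> 2 * n" "57 * b\<^sup>2 \<noteq> 2 * n" "19 * b\<^sup>2 \<noteq> 4 * n" for b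
    using sq[of b] n3 b3[of b] zero_neq_one by metis+
  have "2 * card (prim_reps 9 2 n) = card (neg_roots 9 (int n))"
    using card_prim_reps[of n 2 9] n1 c2 nz norm_9_represents[of "int n"] m by simp
  moreover have "2 * card (prim_reps 19 4 n) = card (neg_roots 19 (int n))"
    using card_prim_reps[of n 4 19] n1 c4 nz norm_19_represents[of "int n"] m by simp
  moreover have "2 * card (prim_reps 57 2 n) = card (neg_roots 57 (int n))"
    using card_prim_reps[of n 2 57] n1 c2 nz norm_57_represents[of "int n"] m by simp
  moreover have "4 dvd card (neg_roots 9 (int n)) + card (neg_roots 19 (int n)) + card (neg_roots 57 (int n))"
    using n1 m by (intro four_dvd_card_neg_roots) auto
  ultimately show ?thesis
    by presburger
qed

text \<open>If \<open>g^2\<close> divides \<open>N\<close> then \<open>g\<close> is coprime to 6, so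
  \<open>g^2\<close> is 1 modulo 12 and \<open>N div g^2\<close> stays in class 5; the primitive
  result applies to every summand.\<close>

lemma even_card_norm_reps:
  fixes N :: nat
  assumes "N mod 12 = 5"
  shows "even (card (norm_reps 9 2 N) + card (norm_reps 19 4 N) + card (norm_reps 57 2 N))"
proof -
  have m: "int N mod 12 = 5"
    using assms by (metis of_nat_mod of_nat_numeral)
  have odd: "odd N"
    using mod_12_imp(1)[of "int N"] m by simp
  then have c2: "coprime 2 N"
    by simp
  have "(4 :: nat) = 2 * 2"
    by simp
  then have c4: "coprime 4 N"
    using c2 by (simp only: coprime_mult_left_iff)
  have N0: "N > 0"
    using assms by (cases "N = 0") auto
  have "even (\<Sum>g | g\<^sup>2 dvd N. card (prim_reps 9 2 (N div g\<^sup>2)) + card (prim_reps 19 4 (N div g\<^sup>2))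
      + card (prim_reps 57 2 (N div g\<^sup>2)))"
  proof (rule dvd_sum)
    fix g assume "g \<in> {g. g\<^sup>2 dvd N}"
    then obtain n where n: "N = g\<^sup>2 * n"
      by (auto elim: dvdE)
    then have g0: "g > 0"
      using N0 by (cases "g = 0") auto
    have "odd (int g)"
      using odd n by simp
    moreover have "\<not> 3 dvd int g"
    proof
      assume "3 dvd int g"
      then have "3 dvd int N"
        unfolding n by (simp add: power2_eq_square)
      then show False
        using mod_12_imp(2)[of "int N"] m by simp
    qed
    ultimately have "int g mod 12 \<in> {1, 5, 7, 11}"
      by (rule mod_12_cases)
    then have "(int g mod 12)\<^sup>2 mod 12 = 1"
      by auto
    then have "(int g)\<^sup>2 mod 12 = 1"
      by (simp only: power_mod)
    then have "g\<^sup>2 mod 12 = 1"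
      by (metis of_nat_1 of_nat_eq_iff of_nat_mod of_nat_numeral of_nat_power)
    then have "n mod 12 = 5"
      using assms unfolding n by (metis mod_mult_left_eq mult_1)
    then show "even (card (prim_reps 9 2 (N div g\<^sup>2)) + card (prim_reps 19 4 (N div g\<^sup>2))
      + card (prim_reps 57 2 (N div g\<^sup>2)))"
      using even_card_prim_reps[of n] g0 unfolding n by simp
  qed
  then show ?thesis
    using c2 c4 N0 by (simp add: card_norm_reps sum.distrib)
qed

section \<open>Pentagonal numbers and norm series\<close>

lemma triangle_Suc: "Suc s * (Suc s + 1) div 2 = s * (s + 1) div 2 + Suc s"
proof -
  have "Suc s * (Suc s + 1) = s * (s + 1) + Suc s * 2"
    by simp
  then have "Suc s * (Suc s + 1) div 2 = (s * (s + 1) + Suc s * 2) div 2"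
    by (rule arg_cong)
  also have "\<dots> = Suc s + s * (s + 1) div 2"
    by (rule div_mult_self1) simp
  finally show ?thesis
    by (simp only: add.commute)
qed

text \<open>
  On the left, all terms with \<open>s > 0\<close> are divisible by \<open>q^(n+1)\<close>, so this is a finite form of Euler's
  pentagonal number theorem.
\<close>

lemma shanks_identity:
  fixes q :: "'a :: comm_ring_1"
  shows "(\<Sum>s\<le>n. (- 1) ^ s * (\<Prod>i\<in>{s<..n}. 1 - q ^ i) * q ^ (s * n + s * (s + 1) div 2))
    = 1 + (\<Sum>j<n. (- 1) ^ Suc j * (q ^ ((Suc j)\<^sup>2 + j * (j + 1) div 2) + q ^ ((Suc j)\<^sup>2 + Suc j * (Suc j + 1) div 2)))"
proof (induction n)
  case (Suc n)
  define P where "P s n = (\<Prod>i\<in>{s<..n}. 1 - q ^ i)" for s n :: nat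
  define tri where "tri s = s * (s + 1) div 2" for s :: nat
  have tri: "tri (Suc s) = tri s + Suc s" for s
    unfolding tri_def by (rule triangle_Suc)
  define T where "T n s = (- 1) ^ s * P s n * q ^ (s * n + tri s)" for n s
  define W where "W s = (- 1) ^ s * P s n * q ^ (Suc s * Suc n + tri s)" for s
  have P_upper: "P s (Suc n) = P s n * (1 - q ^ Suc n)" if "s \<le> n" for s
  proof -
    have "{s<..Suc n} = insert (Suc n) {s<..n}"
      using that by auto
    then show ?thesis
      by (simp add: P_def mult.commute)
  qed
  have P_lower: "P s n = P (Suc s) n * (1 - q ^ Suc s)" if "s < n" for s
  proof -
    have "{s<..n} = insert (Suc s) {Suc s<..n}"
      using that by auto
    then show ?thesis
      by (simp add: P_def mult.commute)
  qed
  \<comment> \<open>Raising \<open>n\<close> changes each summand by two corrections, which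
    telescope against each other by \<open>T1\<close> below.\<close>
  have T0: "T (Suc n) s = T n s - T n s * (1 - q ^ s) - W s" if "s \<le> n" for s
  proof -
    have "q ^ (s * Suc n + tri s) = q ^ (s * n + tri s) * q ^ s"
      by (simp add: power_add)
    moreover have "q ^ (Suc s * Suc n + tri s) = q ^ (s * Suc n + tri s) * q ^ Suc n"
      by (simp add: power_add)
    ultimately show ?thesis
      unfolding T_def W_def P_upper[OF that] by (simp add: algebra_simps)
  qed
  have T1: "T n (Suc s) * (1 - q ^ Suc s) = - W s" if "s < n" for s
  proof -
    have "Suc s * n + tri (Suc s) = Suc s * Suc n + tri s"
      by (simp add: tri)
    then show ?thesis
      unfolding T_def W_def P_lower[OF that] by (simp add: algebra_simps)
  qed
  \<comment> \<open>The term \<open>s = 0\<close> vanishes because of the factor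
    \<open>1 - q ^ 0\<close>, which permits the index shift.\<close>
  have "(\<Sum>s\<le>n. T n s * (1 - q ^ s)) = (\<Sum>s<Suc n. T n s * (1 - q ^ s))"
    by (simp only: lessThan_Suc_atMost)
  also have "\<dots> = (\<Sum>s<n. T n (Suc s) * (1 - q ^ Suc s))"
    by (subst sum.lessThan_Suc_shift) simp
  also have "\<dots> = (\<Sum>s<n. - W s)"
    by (intro sum.cong refl T1) simp
  also have "\<dots> = - (\<Sum>s<n. W s)"
    by (rule sum_negf)
  finally have shift: "(\<Sum>s\<le>n. T n s * (1 - q ^ s)) = - (\<Sum>s<n. W s)" .
  have "(\<Sum>s\<le>Suc n. T (Suc n) s) = (\<Sum>s\<le>n. T n s - T n s * (1 - q ^ s) - W s) + T (Suc n) (Suc n)"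
    by (simp add: T0)
  also have "\<dots> = (\<Sum>s\<le>n. T n s) + (\<Sum>s<n. W s) - (\<Sum>s\<le>n. W s) + T (Suc n) (Suc n)"
    by (simp add: sum_subtractf shift)
  also have "\<dots> = (\<Sum>s\<le>n. T n s) - W n + T (Suc n) (Suc n)"
    by (simp flip: lessThan_Suc_atMost)
  finally have "(\<Sum>s\<le>Suc n. T (Suc n) s) = (\<Sum>s\<le>n. T n s) + (- W n + T (Suc n) (Suc n))"
    by (simp only: diff_conv_add_uminus add.assoc)
  \<comment> \<open>The two boundary terms left by the telescoping are the next pair of pentagonal
    powers.\<close>
  also have "- W n + T (Suc n) (Suc n) = (- 1) ^ Suc n * (q ^ ((Suc n)\<^sup>2 + tri n) + q ^ ((Suc n)\<^sup>2 + tri (Suc n)))"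
    by (simp add: W_def T_def P_def power2_eq_square algebra_simps)
  finally have "(\<Sum>s\<le>Suc n. T (Suc n) s) = (\<Sum>s\<le>n. T n s)
    + (- 1) ^ Suc n * (q ^ ((Suc n)\<^sup>2 + tri n) + q ^ ((Suc n)\<^sup>2 + tri (Suc n)))" .
  moreover have "(\<Sum>s\<le>n. T n s)
    = 1 + (\<Sum>j<n. (- 1) ^ Suc j * (q ^ ((Suc j)\<^sup>2 + tri j) + q ^ ((Suc j)\<^sup>2 + tri (Suc j))))"
    using Suc unfolding T_def P_def tri_def .
  ultimately show ?case
    unfolding T_def P_def tri_def by (simp add: add.assoc)
qed simp

text \<open>
  The series \<open>\<Sum> q^((N x - c)/24)\<close> over \<open>x \<in> S\<close>, meant for \<open>N\<close> with values congruent to \<open>c\<close> modulo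
  24 and finite fibres (elements with other values are dropped, and infinite fibres count as 0).
\<close>

definition norm_series :: "'b set \<Rightarrow> nat \<Rightarrow> ('b \<Rightarrow> nat) \<Rightarrow> bit fps" where
  "norm_series S c N = Abs_fps (\<lambda>k. of_nat (card {x \<in> S. N x = 24 * k + c}))"

text \<open>The fixed residue classes modulo 24 split the fibre of \<open>N x + M y\<close> into
  finitely many products of fibres, which is the Cauchy product.\<close>

lemma norm_series_mult:
  assumes "\<And>x. x \<in> S \<Longrightarrow> \<exists>k. N x = 24 * k + c" "\<And>y. y \<in> T \<Longrightarrow> \<exists>k. M y = 24 * k + d"
    and fin: "\<And>k. finite {x \<in> S. N x = k}" "\<And>k. finite {y \<in> T. M y = k}"
  shows "norm_series S c N * norm_series T d M = norm_series (S \<times> T) (c + d) (\<lambda>(x, y). N x + M y)"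
proof (rule fps_ext)
  fix k
  let ?A = "\<lambda>i. {x \<in> S. N x = 24 * i + c}" and ?B = "\<lambda>i. {y \<in> T. M y = 24 * i + d}"
  have "{p \<in> S \<times> T. (\<lambda>(x, y). N x + M y) p = 24 * k + (c + d)} = (\<Union>i\<in>{0..k}. ?A i \<times> ?B (k - i))"
  proof (intro equalityI subsetI)
    fix p assume "p \<in> {p \<in> S \<times> T. (\<lambda>(x, y). N x + M y) p = 24 * k + (c + d)}"
    then obtain x y where p: "p = (x, y)" "x \<in> S" "y \<in> T" "N x + M y = 24 * k + (c + d)"
      by auto
    obtain i j where "N x = 24 * i + c" "M y = 24 * j + d"
      using assms(1,2) p by blast
    with p have "i \<in> {0..k}" "(x, y) \<in> ?A i \<times> ?B (k - i)"
      by auto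
    then show "p \<in> (\<Union>i\<in>{0..k}. ?A i \<times> ?B (k - i))"
      unfolding p by blast
  qed auto
  moreover have "card (\<Union>i\<in>{0..k}. ?A i \<times> ?B (k - i)) = (\<Sum>i=0..k. card (?A i) * card (?B (k - i)))"
    using fin by (subst card_UN_disjoint) (auto simp: card_cartesian_product)
  ultimately show "fps_nth (norm_series S c N * norm_series T d M) k
    = fps_nth (norm_series (S \<times> T) (c + d) (\<lambda>(x, y). N x + M y)) k"
    by (simp add: norm_series_def fps_mult_nth)
qed

lemma of_nat_bit_eq_iff: "(of_nat m :: bit) = of_nat n \<longleftrightarrow> (even m \<longleftrightarrow> even n)"
  by (metis Z2.bit_eq_iff even_of_nat)

section \<open>Theta series as Euler products modulo 2\<close>

lemma coprime_6_iff: "coprime a (6 :: nat) \<longleftrightarrow> odd a \<and> \<not> 3 dvd a"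
proof -
  have "(6 :: nat) = 2 * 3"
    by simp
  then have "coprime a 6 \<longleftrightarrow> coprime a 2 \<and> coprime a 3"
    by (simp only: coprime_mult_right_iff)
  moreover have "coprime a 3 \<longleftrightarrow> \<not> 3 dvd a"
    using prime_imp_coprime_nat[of 3 a] coprime_common_divisor_nat[of 3 a 3]
    by (auto simp: coprime_commute)
  ultimately show ?thesis
    by simp
qed

text \<open>It suffices to check the residues 1, 5, 7 and 11 modulo 12. Thus
  \<open>(a^2 - 1) / 24\<close> is a natural number exactly for the indices of the theta
  series.\<close>

lemma coprime_6_square_iff: "coprime a (6 :: nat) \<longleftrightarrow> (\<exists>k. a\<^sup>2 = 24 * k + 1)"
proof
  assume "coprime a 6"
  then have "odd (int a)" "\<not> 3 dvd int a"
    unfolding coprime_6_iff by presburger+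
  then have "int a mod 12 \<in> {1, 5, 7, 11}"
    by (rule mod_12_cases)
  moreover have "int a mod 12 = int (a mod 12)"
    by (simp add: zmod_int)
  ultimately have a: "a mod 12 \<in> {1, 5, 7, 11}"
    by auto
  define t where "t = a div 12"
  have sq: "(12 * t + e)\<^sup>2 = 24 * (6 * t\<^sup>2 + t * e) + e\<^sup>2" for e :: nat
    by (simp add: power2_eq_square algebra_simps)
  have "a = 12 * t + a mod 12"
    by (simp add: t_def)
  with a obtain e where e: "a = 12 * t + e" "e \<in> {1, 5, 7, 11}"
    by metis
  then have "\<exists>j. e\<^sup>2 = 24 * j + 1"
    by (auto simp: power2_eq_square)
  then obtain j where "e\<^sup>2 = 24 * j + 1"
    by blast
  then have "a\<^sup>2 = 24 * (6 * t\<^sup>2 + t * e + j) + 1"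
    unfolding e(1) sq by simp
  then show "\<exists>k. a\<^sup>2 = 24 * k + 1"
    by blast
next
  assume "\<exists>k. a\<^sup>2 = 24 * k + 1"
  then obtain k where k: "a\<^sup>2 = 24 * k + 1"
    by blast
  then have "odd (a\<^sup>2)" "\<not> 3 dvd a\<^sup>2"
    by presburger+
  then show "coprime a 6"
    unfolding coprime_6_iff by (auto simp: power2_eq_square)
qed

text \<open>The exponents are \<open>m\<close> times the generalized pentagonal numbers: modulo 2
  this is Euler's product in \<open>q ^ m\<close>.\<close>

abbreviation "theta m \<equiv> norm_series {a. coprime a 6} m (\<lambda>a. m * a\<^sup>2)"

text \<open>Signs disappear in characteristic 2. The pair of powers at index \<open>j\<close> comes
  from \<open>a = 6 * j + 5\<close> and \<open>a = 6 * j + 7\<close>, and the constant term from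
  \<open>a = 1\<close>.\<close>

lemma pentagonal_sum:
  fixes q :: "bit fps"
  shows "1 + (\<Sum>j<n. (- 1) ^ Suc j * (q ^ ((Suc j)\<^sup>2 + j * (j + 1) div 2) + q ^ ((Suc j)\<^sup>2 + Suc j * (Suc j + 1) div 2)))
    = (\<Sum>a | coprime a 6 \<and> a \<le> 6 * n + 1. q ^ ((a\<^sup>2 - 1) div 24))"
proof (induction n)
  case 0
  have "{a. coprime a 6 \<and> a \<le> 6 * 0 + (1 :: nat)} = {1}"
  proof (intro equalityI subsetI)
    fix a assume "a \<in> {a. coprime a 6 \<and> a \<le> 6 * 0 + (1 :: nat)}"
    then show "a \<in> {1}"
      by (cases "a = 0") auto
  qed simp
  then show ?case
    by simp
next
  case (Suc n)
  have "- 1 = (1 :: bit fps)"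
    by (rule fps_ext) simp
  then have sign: "(- 1) ^ j = (1 :: bit fps)" for j
    by (simp only: power_one)
  have sets: "{a. coprime a 6 \<and> a \<le> 6 * Suc n + 1}
      = insert (6 * n + 5) (insert (6 * n + 7) {a. coprime a 6 \<and> a \<le> 6 * n + 1})"
  proof (intro equalityI subsetI)
    fix a assume "a \<in> {a. coprime a 6 \<and> a \<le> 6 * Suc n + 1}"
    then have a: "odd a" "\<not> 3 dvd a" "a \<le> 6 * n + 7" "coprime a 6"
      unfolding coprime_6_iff by auto
    show "a \<in> insert (6 * n + 5) (insert (6 * n + 7) {a. coprime a 6 \<and> a \<le> 6 * n + 1})"
    proof (cases "a \<le> 6 * n + 1")
      case False
      then have "a = 6 * n + 2 \<or> a = 6 * n + 3 \<or> a = 6 * n + 4 \<or> a = 6 * n + 5 \<or> a = 6 * n + 6 \<or> a = 6 * n + 7"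
        using a(3) by linarith
      moreover have "3 dvd 6 * n + 3"
        by presburger
      ultimately show ?thesis
        using a(1,2) by auto
    qed (use a in auto)
  next
    fix a assume a: "a \<in> insert (6 * n + 5) (insert (6 * n + 7) {a. coprime a 6 \<and> a \<le> 6 * n + 1})"
    have "odd (6 * n + 5)" "\<not> 3 dvd 6 * n + 5" "odd (6 * n + 7)" "\<not> 3 dvd 6 * n + 7"
      by presburger+
    then show "a \<in> {a. coprime a 6 \<and> a \<le> 6 * Suc n + 1}"
      using a by (auto simp: coprime_6_iff)
  qed
  have exponent: "(x\<^sup>2 - 1) div 24 = y" if "x\<^sup>2 = 24 * y + 1" for x y :: nat
    using that by simp
  have tri: "2 * (s * (s + 1) div 2) = s * (s + 1)" for s :: nat
    by simp
  have sq: "2 * t = n * (n + 1) \<Longrightarrow> (6 * n + 5)\<^sup>2 = 24 * ((Suc n)\<^sup>2 + t) + 1"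
    "2 * t = Suc n * (Suc n + 1) \<Longrightarrow> (6 * n + 7)\<^sup>2 = 24 * ((Suc n)\<^sup>2 + t) + 1" for t
    by (simp_all add: power2_eq_square algebra_simps)
  have "((6 * n + 5)\<^sup>2 - 1) div 24 = (Suc n)\<^sup>2 + n * (n + 1) div 2"
    by (rule exponent, rule sq(1), rule tri)
  moreover have "((6 * n + 7)\<^sup>2 - 1) div 24 = (Suc n)\<^sup>2 + Suc n * (Suc n + 1) div 2"
    by (rule exponent, rule sq(2), rule tri)
  ultimately have "(\<Sum>a | coprime a 6 \<and> a \<le> 6 * Suc n + 1. q ^ ((a\<^sup>2 - 1) div 24))
    = q ^ ((Suc n)\<^sup>2 + n * (n + 1) div 2) + (q ^ ((Suc n)\<^sup>2 + Suc n * (Suc n + 1) div 2)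
      + (\<Sum>a | coprime a 6 \<and> a \<le> 6 * n + 1. q ^ ((a\<^sup>2 - 1) div 24)))"
    unfolding sets by simp
  then show ?case
    unfolding Suc[symmetric] sum.lessThan_Suc sign by (simp only: mult_1 ac_simps)
qed

text \<open>Up to degree \<open>n\<close> only the summand \<open>s = 0\<close> of the finite
  identity survives. The bound \<open>6 * n + 1\<close> misses no relevant \<open>a\<close>, since
  \<open>24 * n + 1 \<le> (6 * n + 1)^2\<close>.\<close>

lemma pentagonal:
  assumes "m > 0" "k \<le> n"
  shows "fps_nth (\<Prod>i\<in>{0<..n}. 1 - (fps_X ^ m) ^ i) k = fps_nth (theta m) k"
proof -
  define q where "q = (fps_X ^ m :: bit fps)"
  have nth_0: "fps_nth (f * q ^ e) k = 0" if "k < e" for f e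
  proof -
    have "e \<le> m * e"
      using assms(1) by simp
    then have "k < m * e"
      using that by linarith
    then show ?thesis
      by (simp add: q_def fps_X_power_mult_right_nth flip: power_mult)
  qed
  have "fps_nth ((- 1) ^ s * (\<Prod>i\<in>{s<..n}. 1 - q ^ i) * q ^ (s * n + s * (s + 1) div 2)) k = 0"
    if s: "s \<in> {..n} - {0}" for s
  proof (rule nth_0)
    obtain t where "s = Suc t"
      using s by (cases s) auto
    then have "s * (s + 1) div 2 \<ge> 1" "s * n \<ge> n"
      using triangle_Suc[of t] by auto
    then show "k < s * n + s * (s + 1) div 2"
      using assms(2) by linarith
  qed
  then have "(\<Sum>s\<le>n. fps_nth ((- 1) ^ s * (\<Prod>i\<in>{s<..n}. 1 - q ^ i) * q ^ (s * n + s * (s + 1) div 2)) k)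
      = (\<Sum>s\<in>{0}. fps_nth ((- 1) ^ s * (\<Prod>i\<in>{s<..n}. 1 - q ^ i) * q ^ (s * n + s * (s + 1) div 2)) k)"
    by (intro sum.mono_neutral_right) auto
  then have "fps_nth (\<Prod>i\<in>{0<..n}. 1 - q ^ i) k
      = fps_nth (\<Sum>s\<le>n. (- 1) ^ s * (\<Prod>i\<in>{s<..n}. 1 - q ^ i) * q ^ (s * n + s * (s + 1) div 2)) k"
    by (simp add: fps_sum_nth)
  also have "\<dots> = fps_nth (\<Sum>a | coprime a 6 \<and> a \<le> 6 * n + 1. q ^ ((a\<^sup>2 - 1) div 24)) k"
    by (simp only: shanks_identity pentagonal_sum)
  also have "\<dots> = (\<Sum>a | coprime a 6 \<and> a \<le> 6 * n + 1. of_bool (k = m * ((a\<^sup>2 - 1) div 24)))"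
    by (simp add: fps_sum_nth q_def of_bool_def flip: power_mult)
  also have "\<dots> = of_nat (card {a \<in> {a. coprime a 6 \<and> a \<le> 6 * n + 1}. k = m * ((a\<^sup>2 - 1) div 24)})"
  proof -
    have fin: "finite {a. coprime a 6 \<and> a \<le> 6 * n + (1 :: nat)}"
      by (rule finite_subset[of _ "{..6 * n + 1}"]) auto
    show ?thesis
      unfolding of_bool_def sum.inter_filter[OF fin, symmetric] by simp
  qed
  also have "{a \<in> {a. coprime a 6 \<and> a \<le> 6 * n + 1}. k = m * ((a\<^sup>2 - 1) div 24)}
      = {a \<in> {a. coprime a 6}. m * a\<^sup>2 = 24 * k + m}"
  proof (intro equalityI subsetI)
    fix a assume a: "a \<in> {a \<in> {a. coprime a 6 \<and> a \<le> 6 * n + 1}. k = m * ((a\<^sup>2 - 1) div 24)}"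
    then obtain e where e: "a\<^sup>2 = 24 * e + 1"
      using coprime_6_square_iff by auto
    then have "k = m * e"
      using a by simp
    then have "m * a\<^sup>2 = 24 * k + m"
      unfolding e by simp
    then show "a \<in> {a \<in> {a. coprime a 6}. m * a\<^sup>2 = 24 * k + m}"
      using a by simp
  next
    fix a assume a: "a \<in> {a \<in> {a. coprime a 6}. m * a\<^sup>2 = 24 * k + m}"
    then obtain e where e: "a\<^sup>2 = 24 * e + 1"
      using coprime_6_square_iff by auto
    then have "m * (24 * e + 1) = 24 * k + m"
      using a by simp
    then have k: "k = m * e"
      by simp
    have "e \<le> m * e"
      using assms(1) by simp
    then have "e \<le> n"
      using k assms(2) by linarith
    have "n \<le> n * n"
      by (cases n) auto
    have "a\<^sup>2 \<le> 24 * n + 1"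
      using e \<open>e \<le> n\<close> by simp
    also have "\<dots> \<le> 36 * (n * n) + 12 * n + 1"
      using \<open>n \<le> n * n\<close> by linarith
    also have "\<dots> = (6 * n + 1)\<^sup>2"
      by (simp add: power2_eq_square algebra_simps)
    finally have "a \<le> 6 * n + 1"
      by (rule power2_le_imp_le) simp
    then show "a \<in> {a \<in> {a. coprime a 6 \<and> a \<le> 6 * n + 1}. k = m * ((a\<^sup>2 - 1) div 24)}"
      using a k e by simp
  qed
  finally show ?thesis
    by (simp add: norm_series_def q_def)
qed

section \<open>The generating function modulo 2\<close>

text \<open>Used with target \<open>rat\<close>, where the defining product lives, and with target
  \<open>bit\<close> for reduction modulo 2.\<close>

definition of_int_fps :: "int fps \<Rightarrow> 'a :: comm_ring_1 fps" where
  "of_int_fps f = Abs_fps (\<lambda>n. of_int (fps_nth f n))"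

lemma of_int_fps_nth [simp]: "fps_nth (of_int_fps f) n = of_int (fps_nth f n)"
  by (simp add: of_int_fps_def)

lemma of_int_fps_mult: "of_int_fps (f * g) = of_int_fps f * of_int_fps g"
  by (rule fps_ext) (simp add: fps_mult_nth)

lemma of_int_fps_prod_one_minus:
  "of_int_fps (\<Prod>i\<in>A. 1 - fps_X ^ w i) = (\<Prod>i\<in>A. 1 - fps_X ^ w i)"
proof -
  have 1: "of_int_fps 1 = 1" and factor: "of_int_fps (1 - fps_X ^ k) = 1 - fps_X ^ k" for k
    by (rule fps_ext; simp)+
  show ?thesis
    by (induction A rule: infinite_finite_induct) (simp_all add: 1 factor of_int_fps_mult)
qed

lemma b_factor_mult:
  "b_factor l i * (1 - fps_X ^ Suc i) = 1 - fps_X ^ (l * Suc i)"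
proof -
  have "fps_nth (1 - fps_X ^ Suc i :: rat fps) 0 \<noteq> 0"
    by simp
  then have "inverse (1 - fps_X ^ Suc i :: rat fps) * (1 - fps_X ^ Suc i) = 1"
    by (rule inverse_mult_eq_1)
  then show ?thesis
    unfolding b_factor_eq inverse_one_minus_fps_X_power[OF zero_less_Suc, symmetric] mult.assoc by simp
qed

text \<open>Convergence fixes the first coefficients of a partial product; clearing its denominators
  gives an identity over the rationals that descends to the integers. The bound
  \<open>n \<ge> k\<close> makes \<open>pentagonal\<close> applicable at degree
  \<open>k\<close>.\<close>

lemma b_regular_mult_prod:
  assumes "l \<ge> 1"
  shows "\<exists>n\<ge>k. fps_nth (Abs_fps (b_regular l) * (\<Prod>i\<in>{0<..n}. 1 - fps_X ^ i)) k
    = fps_nth (\<Prod>i\<in>{0<..n}. 1 - fps_X ^ (l * i)) k"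
proof -
  define P where "P n = (\<Prod>i\<le>n. b_factor l i)" for n
  define B where "B = (of_int_fps (Abs_fps (b_regular l)) :: rat fps)"
  have B_nth: "fps_nth B j = of_int (b_regular l j)" for j
    by (simp add: B_def)
  have "b_factor l has_prod B"
    using b_regular_has_prod[OF assms] by (simp add: B_def of_int_fps_def)
  then have "P \<longlonglongrightarrow> B"
    unfolding P_def by (metis has_prod_imp_tendsto)
  then have "\<forall>\<^sub>F n in sequentially. fps_nth (P n) j = fps_nth B j" for j
    by (simp add: tendsto_fps_iff)
  then have "\<forall>\<^sub>F n in sequentially. \<forall>j\<in>{0..k}. fps_nth (P n) j = fps_nth B j"
    by (intro eventually_ball_finite) auto
  then have "\<forall>\<^sub>F n in sequentially. n \<ge> k \<and> (\<forall>j\<in>{0..k}. fps_nth (P n) j = fps_nth B j)"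
    using eventually_ge_at_top[of k] by eventually_elim auto
  then obtain n where n: "n \<ge> k" "\<And>j. j \<le> k \<Longrightarrow> fps_nth (P n) j = fps_nth B j"
    by (auto simp: eventually_sequentially)
  \<comment> \<open>\<open>P n\<close> has factors 0 to \<open>n\<close>, which correspond to the
    Euler factors 1 to \<open>Suc n\<close>.\<close>
  have shift: "(\<Prod>i\<in>{0<..Suc n}. f i) = (\<Prod>i\<le>n. f (Suc i))" for f :: "nat \<Rightarrow> rat fps"
    by (rule prod.reindex_bij_witness[of _ Suc "\<lambda>i. i - 1"]) auto
  have "P n * (\<Prod>i\<in>{0<..Suc n}. 1 - fps_X ^ i) = (\<Prod>i\<in>{0<..Suc n}. 1 - fps_X ^ (l * i))"
    unfolding shift P_def prod.distrib[symmetric] b_factor_mult ..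
  moreover have "fps_nth (P n * f) k = fps_nth (B * f) k" for f
    using n(2) by (simp add: fps_mult_nth)
  ultimately have "fps_nth (B * (\<Prod>i\<in>{0<..Suc n}. 1 - fps_X ^ i)) k
      = fps_nth (\<Prod>i\<in>{0<..Suc n}. 1 - fps_X ^ (l * i)) k"
    by metis
  then have "of_int (fps_nth (Abs_fps (b_regular l) * (\<Prod>i\<in>{0<..Suc n}. 1 - fps_X ^ i)) k)
      = (of_int (fps_nth (\<Prod>i\<in>{0<..Suc n}. 1 - fps_X ^ (l * i)) k) :: rat)"
    unfolding of_int_fps_nth[symmetric] of_int_fps_mult of_int_fps_prod_one_minus B_def .
  then show ?thesis
    using n(1) by (intro exI[of _ "Suc n"]) simp
qed

lemma b_regular_theta:
  assumes "l \<ge> 1"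
  shows "of_int_fps (Abs_fps (b_regular l)) * theta 1 = theta l"
proof (rule fps_ext)
  fix k
  obtain n where n: "n \<ge> k" "fps_nth (Abs_fps (b_regular l) * (\<Prod>i\<in>{0<..n}. 1 - fps_X ^ i)) k
    = fps_nth (\<Prod>i\<in>{0<..n}. 1 - fps_X ^ (l * i)) k"
    using b_regular_mult_prod[OF assms] by blast
  define B where "B = (of_int_fps (Abs_fps (b_regular l)) :: bit fps)"
  have "fps_nth (B * (\<Prod>i\<in>{0<..n}. 1 - fps_X ^ i)) k = fps_nth (\<Prod>i\<in>{0<..n}. 1 - fps_X ^ (l * i)) k"
    using arg_cong[OF n(2), of "of_int :: int \<Rightarrow> bit"]
    unfolding of_int_fps_nth[symmetric] of_int_fps_mult of_int_fps_prod_one_minus B_def .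
  moreover have "fps_nth (B * (\<Prod>i\<in>{0<..n}. 1 - fps_X ^ i)) k = fps_nth (B * theta 1) k"
    using pentagonal[of 1] n(1) by (simp add: fps_mult_nth)
  moreover have "fps_nth (\<Prod>i\<in>{0<..n}. 1 - fps_X ^ (l * i)) k = fps_nth (theta l) k"
    using pentagonal[of l k n] n(1) assms by (simp add: power_mult)
  ultimately show "fps_nth (of_int_fps (Abs_fps (b_regular l)) * theta 1) k = fps_nth (theta l) k"
    by (simp add: B_def)
qed

section \<open>Squares and even parts in characteristic 2\<close>

definition even_part :: "'a :: zero fps \<Rightarrow> 'a fps" where
  "even_part f = Abs_fps (\<lambda>n. fps_nth f (2 * n))"

text \<open>Exchanging \<open>i\<close> with \<open>k - i\<close> cancels all terms of the Cauchy
  product except a middle one.\<close>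

lemma bit_fps_square_nth:
  fixes f :: "bit fps"
  shows "fps_nth (f * f) k = (if even k then fps_nth f (k div 2) else 0)"
proof -
  let ?g = "\<lambda>i. fps_nth f i * fps_nth f (k - i)"
  have "fps_nth (f * f) k = sum ?g {i \<in> {0..k}. k - i \<noteq> i} + sum ?g {i \<in> {0..k}. k - i = i}"
  proof -
    have "{0..k} = {i \<in> {0..k}. k - i \<noteq> i} \<union> {i \<in> {0..k}. k - i = i}"
      by auto
    then have "fps_nth (f * f) k = sum ?g ({i \<in> {0..k}. k - i \<noteq> i} \<union> {i \<in> {0..k}. k - i = i})"
      by (simp only: fps_mult_nth)
    then show ?thesis
      by (simp only:) (intro sum.union_disjoint; auto)
  qed
  also have "sum ?g {i \<in> {0..k}. k - i \<noteq> i} = 0"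
    by (rule sum_involution_eq_0[where h = "\<lambda>i. k - i"]) (auto simp: mult.commute)
  also have "{i \<in> {0..k}. k - i = i} = (if even k then {k div 2} else {})"
    by auto presburger
  finally have eq: "fps_nth (f * f) k = 0 + sum ?g (if even k then {k div 2} else {})" .
  have idem: "x * x = x" for x :: bit
    by (cases x) simp_all
  show ?thesis
  proof (cases "even k")
    case True
    then have "k - k div 2 = k div 2"
      by presburger
    then show ?thesis
      using True unfolding eq by (simp add: idem)
  qed (simp add: eq)
qed

text \<open>The square is \<open>g\<close> in the variable \<open>q^2\<close>, so it factors out of
  the even part.\<close>

lemma even_part_mult_square:
  fixes f g :: "bit fps"
  shows "even_part (f * (g * g)) = even_part f * g"
proof (rule fps_ext)
  fix k
  let ?s = "\<lambda>i. fps_nth f i * fps_nth (g * g) (2 * k - i)"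
  have "fps_nth (even_part (f * (g * g))) k = (\<Sum>i=0..2 * k. ?s i)"
    by (simp add: even_part_def fps_mult_nth)
  also have "\<dots> = (\<Sum>i\<in>(*) 2 ` {0..k}. ?s i)"
  proof (rule sum.mono_neutral_right)
    show "\<forall>i\<in>{0..2 * k} - (*) 2 ` {0..k}. ?s i = 0"
    proof
      fix i assume i: "i \<in> {0..2 * k} - (*) 2 ` {0..k}"
      have "odd i"
      proof
        assume "even i"
        then obtain j where "i = 2 * j"
          by (auto elim: evenE)
        then show False
          using i by auto
      qed
      then have "odd (2 * k - i)"
        using i by auto
      then show "?s i = 0"
        by (simp add: bit_fps_square_nth)
    qed
  qed auto
  also have "\<dots> = (\<Sum>i=0..k. ?s (2 * i))"
    by (subst sum.reindex) (auto simp: inj_on_def)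
  also have "\<dots> = (\<Sum>i=0..k. fps_nth (even_part f) i * fps_nth g (k - i))"
    by (intro sum.cong) (auto simp: even_part_def bit_fps_square_nth simp flip: diff_mult_distrib2)
  also have "\<dots> = fps_nth (even_part f * g) k"
    by (simp only: fps_mult_nth)
  finally show "fps_nth (even_part (f * (g * g))) k = fps_nth (even_part f * g) k" .
qed

section \<open>The even part as a sum of theta series\<close>

text \<open>
  Found numerically: modulo 2 this is the generating function of \<open>b_19(2n)\<close>.
\<close>

definition theta_combination :: "bit fps" where
  "theta_combination = norm_series {(a, z). coprime a 6 \<and> z > 0 \<and> \<not> 3 dvd z} 9 (\<lambda>(a, z). a\<^sup>2 + 152 * z\<^sup>2)
    + norm_series {x. odd x} 9 (\<lambda>x. 9 * x\<^sup>2) + norm_series {y. odd y} 9 (\<lambda>y. 57 * y\<^sup>2)"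

text \<open>Residues of squares with explicit quotients, so that congruences on \<open>nat\<close>
  reduce to linear arithmetic.\<close>

lemma square_cases_3: "\<exists>t. (b :: nat)\<^sup>2 = 3 * t \<and> 3 dvd b \<or> b\<^sup>2 = 3 * t + 1 \<and> \<not> 3 dvd b"
proof -
  define s where "s = b div 3"
  have sq: "(3 * s + 1)\<^sup>2 = 3 * (3 * s\<^sup>2 + 2 * s) + 1" "(3 * s + 2)\<^sup>2 = 3 * (3 * s\<^sup>2 + 4 * s + 1) + 1"
    "(3 * s)\<^sup>2 = 3 * (3 * s\<^sup>2)"
    by (simp_all add: power2_eq_square algebra_simps)
  have "\<not> 3 dvd 3 * s + 1" "\<not> 3 dvd 3 * s + 2"
    by presburger+
  moreover have "b = 3 * s \<or> b = 3 * s + 1 \<or> b = 3 * s + 2"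
    unfolding s_def by presburger
  ultimately show ?thesis
    using sq by (metis dvd_triv_left)
qed

lemma square_cases_8: "\<exists>t. (b :: nat)\<^sup>2 = 4 * t \<and> even b \<or> b\<^sup>2 = 8 * t + 1 \<and> odd b"
proof (cases "even b")
  case True
  then obtain s where "b = 2 * s"
    by (auto elim: evenE)
  then show ?thesis
    by (intro exI[of _ "s\<^sup>2"]) (simp add: power2_eq_square)
next
  case False
  then obtain s where s: "b = 2 * s + 1"
    by (auto elim: oddE)
  have "even (s * (s + 1))"
    by simp
  then obtain w where "s * (s + 1) = 2 * w"
    by (rule evenE)
  then have "b\<^sup>2 = 8 * w + 1"
    unfolding s by (simp add: power2_eq_square algebra_simps)
  then show ?thesis
    using False by blast
qed

lemma finite_norm_le:
  fixes N :: "nat \<Rightarrow> nat"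
  assumes "\<And>x. x \<le> N x"
  shows "finite {x \<in> S. N x = k}"
  by (rule finite_subset[of _ "{..k}"]) (use assms in auto)

lemma finite_norm_pair_le:
  fixes N :: "nat \<times> nat \<Rightarrow> nat"
  assumes "\<And>x y. x \<le> N (x, y) \<and> y \<le> N (x, y)"
  shows "finite {p \<in> S. N p = k}"
proof (rule finite_subset[of _ "{..k} \<times> {..k}"])
  show "{p \<in> S. N p = k} \<subseteq> {..k} \<times> {..k}"
    using assms by auto
qed simp

lemma le_mult_square: "D > 0 \<Longrightarrow> (x :: nat) \<le> D * x\<^sup>2"
  by (rule order_trans[of _ "x\<^sup>2"]) (simp_all add: power2_eq_square)

text \<open>The class modulo 24 demanded by \<open>norm_series_mult\<close>; here
  \<open>1 + 152 = 24 * 6 + 9\<close>.\<close>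

lemma theta_combination_wf:
  "\<exists>k. a\<^sup>2 + 152 * z\<^sup>2 = 24 * k + 9" if "coprime a 6" and z: "\<not> 3 dvd z" for a z :: nat
proof -
  obtain s where "a\<^sup>2 = 24 * s + 1"
    using \<open>coprime a 6\<close> coprime_6_square_iff by blast
  moreover obtain t where "z\<^sup>2 = 3 * t + 1"
    using square_cases_3[of z] z by blast
  ultimately have "a\<^sup>2 + 152 * z\<^sup>2 = 24 * (s + 19 * t + 6) + 9"
    by simp
  then show ?thesis
    by blast
qed

lemma odd_square_wf: "\<exists>k. 9 * x\<^sup>2 = 24 * k + 9" "\<exists>k. 57 * x\<^sup>2 = 24 * k + 9" if odd: "odd x" for x :: nat
proof -
  obtain t where "x\<^sup>2 = 8 * t + 1"
    using square_cases_8[of x] odd by blast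
  then have "9 * x\<^sup>2 = 24 * (3 * t) + 9" "57 * x\<^sup>2 = 24 * (19 * t + 2) + 9"
    by simp_all
  then show "\<exists>k. 9 * x\<^sup>2 = 24 * k + 9" "\<exists>k. 57 * x\<^sup>2 = 24 * k + 9"
    by blast+
qed

lemma theta_wf: "\<exists>k. m * a\<^sup>2 = 24 * k + m" if a: "coprime a 6" for a m :: nat
proof -
  obtain s where "a\<^sup>2 = 24 * s + 1"
    using a coprime_6_square_iff by blast
  then have "m * a\<^sup>2 = 24 * (m * s) + m"
    by simp
  then show ?thesis
    by blast
qed

section \<open>Coefficients of products with theta\<close>

lemma theta_mult_nth:
  "fps_nth (theta 19 * theta 1) (2 * k)
    = of_nat (card {(b, a). coprime a 6 \<and> coprime b 6 \<and> a\<^sup>2 + 19 * b\<^sup>2 = 4 * (12 * k + 5)})"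
proof -
  have "theta 19 * theta 1 = norm_series ({a. coprime a 6} \<times> {a. coprime a 6}) (19 + 1) (\<lambda>(x, y). 19 * x\<^sup>2 + 1 * y\<^sup>2)"
    by (intro norm_series_mult finite_norm_le le_mult_square) (auto intro: theta_wf theta_wf[of _ 1, simplified])
  then have "fps_nth (theta 19 * theta 1) (2 * k)
    = of_nat (card {p \<in> {a. coprime a 6} \<times> {a. coprime a 6}. (case p of (x, y) \<Rightarrow> 19 * x\<^sup>2 + 1 * y\<^sup>2) = 24 * (2 * k) + (19 + 1)})"
    by (simp only: norm_series_def fps_nth_Abs_fps)
  also have "{p \<in> {a. coprime a 6} \<times> {a. coprime a 6}. (case p of (x, y) \<Rightarrow> 19 * x\<^sup>2 + 1 * y\<^sup>2) = 24 * (2 * k) + (19 + 1)}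
    = {(b, a). coprime a 6 \<and> coprime b 6 \<and> a\<^sup>2 + 19 * b\<^sup>2 = 4 * (12 * k + 5)}"
    by auto
  finally show ?thesis .
qed

lemma mod_neq: "c mod m \<noteq> d mod m \<Longrightarrow> c + m * x \<noteq> d + m * (y :: nat)"
  by (metis mod_mult_self2)

text \<open>The value is 2 modulo 4 and \<open>D\<close> is 1 modulo 4, so both variables are odd;
  it is 1 modulo 3 and 3 divides \<open>D\<close>, so 3 does not divide \<open>a\<close>.\<close>

lemma norm_parity:
  fixes a x :: nat
  assumes "a\<^sup>2 + D * x\<^sup>2 = 24 * k + 10" "D = 9 \<or> D = 57"
  shows "odd x" "coprime a 6" "a > 0"
proof -
  obtain s where s: "a\<^sup>2 = 4 * s \<and> even a \<or> a\<^sup>2 = 8 * s + 1 \<and> odd a"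
    using square_cases_8 by blast
  obtain t where t: "x\<^sup>2 = 4 * t \<and> even x \<or> x\<^sup>2 = 8 * t + 1 \<and> odd x"
    using square_cases_8 by blast
  obtain u where u: "a\<^sup>2 = 3 * u \<and> 3 dvd a \<or> a\<^sup>2 = 3 * u + 1 \<and> \<not> 3 dvd a"
    using square_cases_3 by blast
  have 1: "odd x \<and> odd a"
  proof (rule ccontr)
    assume "\<not> (odd x \<and> odd a)"
    then consider "x\<^sup>2 = 4 * t" "a\<^sup>2 = 4 * s" | "x\<^sup>2 = 4 * t" "a\<^sup>2 = 8 * s + 1" | "x\<^sup>2 = 8 * t + 1" "a\<^sup>2 = 4 * s"
      using s t by blast
    then show False
    proof cases
      case 1
      then have "0 + 4 * (s + D * t) = 2 + 4 * (6 * k + 2)"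
        using assms by auto
      then show False
        using mod_neq[of 0 4 2 "s + D * t" "6 * k + 2"] by simp
    next
      case 2
      then have "1 + 4 * (2 * s + D * t) = 2 + 4 * (6 * k + 2)"
        using assms by auto
      then show False
        using mod_neq[of 1 4 2 "2 * s + D * t" "6 * k + 2"] by simp
    next
      case 3
      then have "1 + 4 * (s + 18 * t + 2) = 2 + 4 * (6 * k + 2) \<or> 1 + 4 * (s + 114 * t + 14) = 2 + 4 * (6 * k + 2)"
        using assms by auto
      then show False
        using mod_neq[of 1 4 2 "s + 18 * t + 2" "6 * k + 2"] mod_neq[of 1 4 2 "s + 114 * t + 14" "6 * k + 2"]
        by (elim disjE) simp_all
    qed
  qed
  moreover have "\<not> 3 dvd a"
  proof
    assume "3 dvd a"
    then have "a\<^sup>2 = 3 * u"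
      using u by blast
    then have "0 + 3 * (u + 3 * x\<^sup>2) = 1 + 3 * (8 * k + 3) \<or> 0 + 3 * (u + 19 * x\<^sup>2) = 1 + 3 * (8 * k + 3)"
      using assms by auto
    then show False
      using mod_neq[of 0 3 1 "u + 3 * x\<^sup>2" "8 * k + 3"] mod_neq[of 0 3 1 "u + 19 * x\<^sup>2" "8 * k + 3"]
      by (elim disjE) simp_all
  qed
  ultimately show "odd x" "coprime a 6" "a > 0"
    by (auto simp: coprime_6_iff intro: gr0I)
qed

lemma card_norm_reps_odd:
  assumes "D = 9 \<or> D = 57"
  shows "card {p \<in> {x. odd x} \<times> {a. coprime a 6}. (case p of (x, a) \<Rightarrow> D * x\<^sup>2 + 1 * a\<^sup>2) = 24 * k + (9 + 1)}
    = card (norm_reps D 2 (12 * k + 5))"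
proof -
  let ?X = "{p \<in> {x. odd x} \<times> {a. coprime a 6}. (case p of (x, a) \<Rightarrow> D * x\<^sup>2 + 1 * a\<^sup>2) = 24 * k + (9 + 1)}"
  have "(\<lambda>(x, a). (a, x)) ` ?X = norm_reps D 2 (12 * k + 5)"
  proof (intro equalityI subsetI)
    fix p assume "p \<in> norm_reps D 2 (12 * k + 5)"
    then obtain a x where p: "p = (a, x)" "a > 0" "x > 0" and eq: "a\<^sup>2 + D * x\<^sup>2 = 24 * k + 10"
      by (auto simp: norm_reps_def)
    have "(x, a) \<in> ?X"
      using norm_parity[OF eq assms] eq by (simp add: add.commute)
    then show "p \<in> (\<lambda>(x, a). (a, x)) ` ?X"
      unfolding p by force
  next
    fix p assume "p \<in> (\<lambda>(x, a). (a, x)) ` ?X"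
    then obtain a x where p: "p = (a, x)" "odd x" and eq: "a\<^sup>2 + D * x\<^sup>2 = 24 * k + 10"
      by (auto simp: add.commute)
    then show "p \<in> norm_reps D 2 (12 * k + 5)"
      using norm_parity[OF eq assms] by (auto simp: norm_reps_def odd_pos)
  qed
  then have "card (norm_reps D 2 (12 * k + 5)) = card ((\<lambda>(x, a). (a, x)) ` ?X)"
    by simp
  also have "\<dots> = card ?X"
    by (rule card_image) (auto simp: inj_on_def)
  finally show ?thesis ..
qed

text \<open>The variables have equal parity. If both are even, the halved equation modulo 4 forces
  \<open>b div 2\<close> to be even and \<open>a div 2\<close> odd. Modulo 3 the equation says that
  two squares add up to 2, so neither is divisible by 3.\<close>

lemma norm_19_cases:
  fixes a b :: nat
  assumes eq: "a\<^sup>2 + 19 * b\<^sup>2 = 4 * (12 * k + 5)" and "b > 0"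
  shows "coprime a 6 \<and> coprime b 6
    \<or> (\<exists>c z. a = 2 * c \<and> b = 4 * z \<and> coprime c 6 \<and> \<not> 3 dvd z \<and> z > 0 \<and> c\<^sup>2 + 76 * z\<^sup>2 = 12 * k + 5)"
proof -
  have mod_3: "\<not> 3 dvd x \<and> \<not> 3 dvd y" if "x\<^sup>2 + (3 * d + 1) * y\<^sup>2 = 3 * e + 2" for x y d e :: nat
  proof -
    obtain u where u: "x\<^sup>2 = 3 * u \<and> 3 dvd x \<or> x\<^sup>2 = 3 * u + 1 \<and> \<not> 3 dvd x"
      using square_cases_3 by blast
    obtain v where v: "y\<^sup>2 = 3 * v \<and> 3 dvd y \<or> y\<^sup>2 = 3 * v + 1 \<and> \<not> 3 dvd y"
      using square_cases_3 by blast
    have "x\<^sup>2 + y\<^sup>2 + 3 * (d * y\<^sup>2) = 3 * e + 2"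
      using that by (simp add: algebra_simps)
    then have "\<not> (x\<^sup>2 = 3 * u \<and> y\<^sup>2 = 3 * v)" "\<not> (x\<^sup>2 = 3 * u \<and> y\<^sup>2 = 3 * v + 1)"
      "\<not> (x\<^sup>2 = 3 * u + 1 \<and> y\<^sup>2 = 3 * v)"
      using mod_neq[of 0 3 2 "u + v + d * y\<^sup>2" e] mod_neq[of 1 3 2 "u + v + d * y\<^sup>2" e] by auto
    then show ?thesis
      using u v by blast
  qed
  have "odd a \<longleftrightarrow> odd b"
    using arg_cong[OF eq, of even] by simp
  then consider "odd a" "odd b" | "even a" "even b"
    by blast
  then show ?thesis
  proof cases
    case 1
    have "a\<^sup>2 + (3 * 6 + 1) * b\<^sup>2 = 3 * (16 * k + 6) + 2"
      using eq by simp
    then show ?thesis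
      using mod_3 1 by (simp only: coprime_6_iff) blast
  next
    case 2
    then obtain c d where cd: "a = 2 * c" "b = 2 * d"
      by (auto elim!: evenE)
    have eq': "c\<^sup>2 + 19 * d\<^sup>2 = 12 * k + 5"
      using eq unfolding cd by (simp add: power_mult_distrib)
    obtain s where s: "c\<^sup>2 = 4 * s \<and> even c \<or> c\<^sup>2 = 8 * s + 1 \<and> odd c"
      using square_cases_8 by blast
    obtain t where t: "d\<^sup>2 = 4 * t \<and> even d \<or> d\<^sup>2 = 8 * t + 1 \<and> odd d"
      using square_cases_8 by blast
    have "even d \<and> odd c"
    proof (rule ccontr)
      assume "\<not> (even d \<and> odd c)"
      then consider "d\<^sup>2 = 4 * t" "c\<^sup>2 = 4 * s" | "d\<^sup>2 = 8 * t + 1" "c\<^sup>2 = 8 * s + 1" | "d\<^sup>2 = 8 * t + 1" "c\<^sup>2 = 4 * s"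
        using s t by blast
      then show False
        using eq' mod_neq[of 0 4 1 "s + 19 * t" "3 * k + 1"] mod_neq[of 0 4 1 "2 * s + 38 * t + 5" "3 * k + 1"]
          mod_neq[of 3 4 1 "s + 38 * t + 4" "3 * k + 1"]
        by cases simp_all
    qed
    then obtain z where z: "d = 2 * z" "odd c"
      by (auto elim: evenE)
    have eq'': "c\<^sup>2 + 76 * z\<^sup>2 = 12 * k + 5"
      using eq' unfolding z by (simp add: power_mult_distrib)
    then have "c\<^sup>2 + (3 * 25 + 1) * z\<^sup>2 = 3 * (4 * k + 1) + 2"
      by simp
    then have "\<not> 3 dvd c \<and> \<not> 3 dvd z"
      by (rule mod_3)
    then show ?thesis
      using z cd eq'' \<open>b > 0\<close> by (auto simp: coprime_6_iff)
  qed
qed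

lemma card_norm_reps_19:
  "card (norm_reps 19 4 (12 * k + 5))
    = card {(a, z). coprime a 6 \<and> z > 0 \<and> \<not> 3 dvd z \<and> a\<^sup>2 + 76 * z\<^sup>2 = 12 * k + 5}
    + card {(b, a). coprime a 6 \<and> coprime b 6 \<and> a\<^sup>2 + 19 * b\<^sup>2 = 4 * (12 * k + 5)}"
proof -
  let ?E = "{(a, z). coprime a 6 \<and> z > 0 \<and> \<not> 3 dvd z \<and> a\<^sup>2 + 76 * z\<^sup>2 = 12 * k + 5}"
  let ?O = "{(b, a). coprime a 6 \<and> coprime b 6 \<and> a\<^sup>2 + 19 * b\<^sup>2 = 4 * (12 * k + 5)}"
  let ?e = "\<lambda>(a, z). (2 * a, 4 * z)" and ?o = "\<lambda>(b, a). (a, b)"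
  have pos: "a > 0" if "coprime a 6" for a :: nat
    using that by (cases a) auto
  have "norm_reps 19 4 (12 * k + 5) = ?e ` ?E \<union> ?o ` ?O"
  proof (intro equalityI subsetI)
    fix p assume "p \<in> norm_reps 19 4 (12 * k + 5)"
    then obtain a b where p: "p = (a, b)" and "b > 0" and eq: "a\<^sup>2 + 19 * b\<^sup>2 = 4 * (12 * k + 5)"
      by (auto simp: norm_reps_def)
    then consider "(b, a) \<in> ?O" | c z where "a = 2 * c" "b = 4 * z" "(c, z) \<in> ?E"
      using norm_19_cases[OF eq \<open>b > 0\<close>] by blast
    then show "p \<in> ?e ` ?E \<union> ?o ` ?O"
      unfolding p by cases force+
  qed (use pos in \<open>auto simp: norm_reps_def power_mult_distrib\<close>)
  moreover have "?e ` ?E \<inter> ?o ` ?O = {}"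
    by (auto simp: coprime_6_iff)
  moreover have "finite (norm_reps 19 4 (12 * k + 5))"
    by (rule finite_norm_reps) simp
  moreover have "card (?e ` ?E) = card ?E" "card (?o ` ?O) = card ?O"
    by (intro card_image; auto simp: inj_on_def)+
  ultimately show ?thesis
    by (simp add: card_Un_disjoint)
qed

text \<open>The involution exchanges \<open>a\<close> with the variable of \<open>theta 1\<close>.
  On its fixed points the equation becomes \<open>2 * a^2 + 152 * z^2 = 24 * k + 10\<close>, which
  halves to the one on the right.\<close>

lemma even_card_triples:
  "even (card {p \<in> {(a, z). coprime a 6 \<and> z > 0 \<and> \<not> 3 dvd z} \<times> {a. coprime a 6}.
      (case p of (x, y) \<Rightarrow> (case x of (a, z) \<Rightarrow> a\<^sup>2 + 152 * z\<^sup>2) + 1 * y\<^sup>2) = 24 * k + (9 + 1)})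
    \<longleftrightarrow> even (card {(a, z). coprime a 6 \<and> z > (0 :: nat) \<and> \<not> 3 dvd z \<and> a\<^sup>2 + 76 * z\<^sup>2 = 12 * k + (5 :: nat)})"
proof -
  let ?X = "{p \<in> {(a, z). coprime a 6 \<and> z > 0 \<and> \<not> 3 dvd z} \<times> {a. coprime a 6}.
      (case p of (x, y) \<Rightarrow> (case x of (a, z) \<Rightarrow> a\<^sup>2 + 152 * z\<^sup>2) + 1 * y\<^sup>2) = 24 * k + (9 + 1 :: nat)}"
  let ?E = "{(a, z). coprime a 6 \<and> z > (0 :: nat) \<and> \<not> 3 dvd z \<and> a\<^sup>2 + 76 * z\<^sup>2 = 12 * k + (5 :: nat)}"
  define h where "h = (\<lambda>((a :: nat, z :: nat), b :: nat). ((b, z), a))"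
  have "finite ?X"
  proof (rule finite_subset)
    show "?X \<subseteq> ({..24 * k + 10} \<times> {..24 * k + 10}) \<times> {..24 * k + 10}"
    proof
      fix p assume "p \<in> ?X"
      then obtain a z b where p: "p = ((a, z), b)" "a\<^sup>2 + 152 * z\<^sup>2 + b\<^sup>2 = 24 * k + 10"
        by auto
      then show "p \<in> ({..24 * k + 10} \<times> {..24 * k + 10}) \<times> {..24 * k + 10}"
        using le_mult_square[of 1 a] le_mult_square[of 152 z] le_mult_square[of 1 b] by simp
    qed
  qed simp
  then have "even (card ?X) \<longleftrightarrow> even (card {p \<in> ?X. h p = p})"
    by (rule even_card_involution) (auto simp: h_def)
  also have "{p \<in> ?X. h p = p} = (\<lambda>(a, z). ((a, z), a)) ` ?E"
    by (auto simp: h_def image_iff)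
  also have "card \<dots> = card ?E"
    by (rule card_image) (auto simp: inj_on_def)
  finally show ?thesis .
qed

text \<open>The left coefficient counts triples and representations by the forms for 9 and 57. The
  triples have the parity of \<open>?E\<close>, the even solutions for 19; as the three binary
  counts have an even sum, the parity left over is that of \<open>?O\<close>, the odd solutions,
  which the right side counts.\<close>

lemma theta_combination_theta: "theta_combination * theta 1 = even_part (theta 19 * theta 1)"
proof (rule fps_ext)
  fix k
  let ?S = "{(a, z). coprime a 6 \<and> z > (0 :: nat) \<and> \<not> 3 dvd z}"
  let ?X = "{p \<in> ?S \<times> {a. coprime a 6}.
      (case p of (x, y) \<Rightarrow> (case x of (a, z) \<Rightarrow> a\<^sup>2 + 152 * z\<^sup>2) + 1 * y\<^sup>2) = 24 * k + (9 + 1)}"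
  let ?Y = "\<lambda>D. {p \<in> {x. odd x} \<times> {a. coprime a 6}. (case p of (x, a) \<Rightarrow> D * x\<^sup>2 + 1 * a\<^sup>2) = 24 * k + (9 + 1)}"
  let ?E = "{(a, z). coprime a 6 \<and> z > (0 :: nat) \<and> \<not> 3 dvd z \<and> a\<^sup>2 + 76 * z\<^sup>2 = 12 * k + (5 :: nat)}"
  let ?O = "{(b, a). coprime a 6 \<and> coprime b 6 \<and> a\<^sup>2 + 19 * b\<^sup>2 = 4 * (12 * k + (5 :: nat))}"
  have fin: "finite {p \<in> ?S. (case p of (a, z) \<Rightarrow> a\<^sup>2 + 152 * z\<^sup>2) = j}" for j
    using le_mult_square[of 1] le_mult_square[of 152]
    by (intro finite_norm_pair_le) (auto intro: trans_le_add1 trans_le_add2)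
  have wf: "\<exists>k. 1 * a\<^sup>2 = 24 * k + 1" if "a \<in> {a. coprime a 6}" for a :: nat
    using theta_wf[of a 1] that by simp
  have "norm_series ?S 9 (\<lambda>(a, z). a\<^sup>2 + 152 * z\<^sup>2) * theta 1
      = norm_series (?S \<times> {a. coprime a 6}) (9 + 1) (\<lambda>(x, y). (case x of (a, z) \<Rightarrow> a\<^sup>2 + 152 * z\<^sup>2) + 1 * y\<^sup>2)"
    by (intro norm_series_mult fin wf finite_norm_le le_mult_square) (auto intro: theta_combination_wf)
  moreover have "norm_series {x. odd x} 9 (\<lambda>x. D * x\<^sup>2) * theta 1
      = norm_series ({x. odd x} \<times> {a. coprime a 6}) (9 + 1) (\<lambda>(x, a). D * x\<^sup>2 + 1 * a\<^sup>2)" if "D = 9 \<or> D = 57" for D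
    using that by (intro norm_series_mult wf finite_norm_le le_mult_square) (auto intro: odd_square_wf)
  ultimately have "fps_nth (theta_combination * theta 1) k
      = of_nat (card ?X) + of_nat (card (?Y 9)) + of_nat (card (?Y 57))"
    by (simp only: theta_combination_def distrib_right fps_add_nth norm_series_def fps_nth_Abs_fps simp_thms)
  also have "\<dots> = of_nat (card ?X + card (norm_reps 9 2 (12 * k + 5)) + card (norm_reps 57 2 (12 * k + 5)))"
    by (simp only: card_norm_reps_odd simp_thms of_nat_add)
  also have "\<dots> = of_nat (card ?O)"
  proof -
    have "even (card (norm_reps 9 2 (12 * k + 5)) + (card ?E + card ?O) + card (norm_reps 57 2 (12 * k + 5)))"
      unfolding card_norm_reps_19[symmetric] by (rule even_card_norm_reps) simp
    moreover have "even (card ?X) \<longleftrightarrow> even (card ?E)"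
      by (rule even_card_triples)
    ultimately show ?thesis
      unfolding of_nat_bit_eq_iff even_add by blast
  qed
  also have "\<dots> = fps_nth (even_part (theta 19 * theta 1)) k"
    by (simp only: even_part_def fps_nth_Abs_fps theta_mult_nth)
  finally show "fps_nth (theta_combination * theta 1) k = fps_nth (even_part (theta 19 * theta 1)) k" .
qed

text \<open>Multiplying \<open>B * theta 1 = theta 19\<close> by \<open>theta 1\<close> creates a
  square that leaves the even part as a single \<open>theta 1\<close>; this nonzero factor is then
  cancelled.\<close>

lemma b_regular_even_part: "of_int (b_regular 19 (2 * n)) = fps_nth theta_combination n"
proof -
  define B where "B = (of_int_fps (Abs_fps (b_regular 19)) :: bit fps)"
  have "even_part B * theta 1 = even_part (B * (theta 1 * theta 1))"
    by (rule even_part_mult_square[symmetric])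
  also have "B * (theta 1 * theta 1) = theta 19 * theta 1"
    using b_regular_theta[of 19] by (simp add: B_def flip: mult.assoc)
  also have "even_part (theta 19 * theta 1) = theta_combination * theta 1"
    by (rule theta_combination_theta[symmetric])
  finally have eq: "even_part B * theta 1 = theta_combination * theta 1" .
  have "{a \<in> {a. coprime a (6 :: nat)}. 1 * a\<^sup>2 = 24 * 0 + 1} = {1}"
    by auto
  then have "fps_nth (theta 1) 0 = 1"
    by (simp add: norm_series_def)
  then have "theta 1 \<noteq> 0"
    by auto
  then have "even_part B = theta_combination"
    using eq by simp
  then show ?thesis
    by (auto simp: B_def even_part_def fps_eq_iff)
qed

section \<open>Self-similarity under scaling by 5\<close>

text \<open>The norm at \<open>5 * n + 4\<close> is \<open>5 * (24 * n + 21)\<close>, so every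
  solution is scaled from some \<open>y\<close> with \<open>5 * N y = 24 * n + 21\<close>. This
  needs \<open>n = 5 * t + 1\<close>, and then \<open>N y = 24 * t + 9\<close>.\<close>

lemma norm_series_5:
  assumes "inj sc" "\<And>x. x \<in> S \<Longrightarrow> sc x \<in> S" "\<And>x. N (sc x) = 25 * N x"
    and "\<And>x. x \<in> S \<Longrightarrow> 5 dvd N x \<Longrightarrow> \<exists>y\<in>S. x = sc y"
  shows "fps_nth (norm_series S 9 N) (5 * n + 4) = (if n mod 5 = 1 then fps_nth (norm_series S 9 N) (n div 5) else 0)"
proof -
  have "{x \<in> S. N x = 24 * (5 * n + 4) + 9} = (if n mod 5 = 1 then sc ` {x \<in> S. N x = 24 * (n div 5) + 9} else {})"
  proof (intro equalityI subsetI)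
    fix x assume x: "x \<in> {x \<in> S. N x = 24 * (5 * n + 4) + 9}"
    then have N: "N x = 5 * (24 * n + 21)"
      by simp
    then have "5 dvd N x"
      by simp
    then obtain y where y: "y \<in> S" "x = sc y"
      using assms(4) x by blast
    have "5 * N y = 24 * n + 21"
      using N unfolding y(2) assms(3) by simp
    moreover have "n = 5 * (n div 5) + n mod 5"
      by simp
    moreover have "n mod 5 = 0 \<or> n mod 5 = 1 \<or> n mod 5 = 2 \<or> n mod 5 = 3 \<or> n mod 5 = 4"
      by presburger
    ultimately have "n mod 5 = 1 \<and> N y = 24 * (n div 5) + 9"
      using mod_neq[of 0 5 1 "N y" "24 * (n div 5) + 4"] mod_neq[of 0 5 4 "N y" "24 * (n div 5) + 13"]
        mod_neq[of 0 5 3 "N y" "24 * (n div 5) + 18"] mod_neq[of 0 5 2 "N y" "24 * (n div 5) + 23"]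
      by (elim disjE) simp_all
    then show "x \<in> (if n mod 5 = 1 then sc ` {x \<in> S. N x = 24 * (n div 5) + 9} else {})"
      using y by auto
  next
    fix x assume x: "x \<in> (if n mod 5 = 1 then sc ` {x \<in> S. N x = 24 * (n div 5) + 9} else {})"
    then have n: "n mod 5 = 1"
      by (auto split: if_splits)
    then obtain y where y: "y \<in> S" "N y = 24 * (n div 5) + 9" "x = sc y"
      using x by auto
    define t where "t = n div 5"
    have "n = 5 * t + 1"
      using n mult_div_mod_eq[of 5 n] unfolding t_def by simp
    then have "25 * N y = 24 * (5 * n + 4) + 9"
      using y(2) unfolding t_def[symmetric] by simp
    then show "x \<in> {x \<in> S. N x = 24 * (5 * n + 4) + 9}"
      using y assms(2,3) by simp
  qed
  moreover have "card (sc ` A) = card A" for A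
    by (rule card_image) (rule inj_on_subset[OF assms(1)], simp)
  ultimately show ?thesis
    by (simp add: norm_series_def)
qed

text \<open>-152 is 3 modulo 5, a nonresidue, so the form is anisotropic modulo 5.\<close>

lemma five_dvd_norm:
  fixes a z :: nat
  assumes "5 dvd a\<^sup>2 + 152 * z\<^sup>2"
  shows "5 dvd a" "5 dvd z"
proof -
  have "5 dvd int (a\<^sup>2 + 152 * z\<^sup>2)"
    using assms by (metis int_dvd_int_iff of_nat_numeral)
  then have "((int a)\<^sup>2 + 152 * (int z)\<^sup>2) mod 5 = 0"
    by (simp only: of_nat_add of_nat_mult of_nat_power of_nat_numeral dvd_eq_mod_eq_0)
  then have "(int a)\<^sup>2 mod 5 = 0" "(int z)\<^sup>2 mod 5 = 0"
    using norm_mod[of "(int a)\<^sup>2" 152 "(int z)\<^sup>2" 5] square_mod_5[of "int a"] square_mod_5[of "int z"] by auto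
  then have "5 dvd (int a)\<^sup>2" "5 dvd (int z)\<^sup>2"
    by (simp_all only: dvd_eq_mod_eq_0)
  moreover have "prime (5 :: int)"
    by (simp add: prime_int_numeral_eq)
  ultimately have "5 dvd int a" "5 dvd int z"
    using prime_dvd_power by blast+
  then show "5 dvd a" "5 dvd z"
    by presburger+
qed

lemma five_dvd_mult_square:
  fixes x :: nat
  assumes "5 dvd D * x\<^sup>2" "\<not> 5 dvd D"
  shows "5 dvd x"
proof -
  have "prime (5 :: nat)"
    by (simp add: prime_nat_numeral_eq)
  then show ?thesis
    using assms prime_dvd_mult_iff prime_dvd_power by blast
qed

text \<open>Multiplying or dividing by 5 respects the conditions modulo 2 and 3 on the index sets,
  so each of the three series is self-similar.\<close>

lemma theta_combination_5:
  "fps_nth theta_combination (5 * n + 4) = (if n mod 5 = 1 then fps_nth theta_combination (n div 5) else 0)"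
proof -
  have odd: "\<exists>y\<in>{x. odd x}. x = 5 * y" if x: "odd x" "5 dvd D * x\<^sup>2" "\<not> 5 dvd D" for x D :: nat
  proof -
    obtain y where "x = 5 * y"
      using five_dvd_mult_square[OF x(2,3)] by (rule dvdE)
    then show ?thesis
      using x(1) by auto
  qed
  let ?S = "{(a, z). coprime a 6 \<and> z > (0 :: nat) \<and> \<not> 3 dvd z}"
  have pair: "\<exists>q\<in>?S. p = (\<lambda>(a, z). (5 * a, 5 * z)) q" if *: "p \<in> ?S" "5 dvd (case p of (a, z) \<Rightarrow> a\<^sup>2 + 152 * z\<^sup>2)" for p
  proof -
    obtain a z where p: "p = (a, z)"
      by force
    then have "5 dvd a\<^sup>2 + 152 * z\<^sup>2"
      using * by simp
    then obtain c d where "a = 5 * c" "z = 5 * d"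
      using five_dvd_norm by (metis dvdE)
    then have "(c, d) \<in> ?S" "p = (5 * c, 5 * d)"
      using *(1) by (auto simp: p coprime_6_iff)
    then show ?thesis
      by force
  qed
  have three: "\<not> 3 dvd 5 * z" if "\<not> 3 dvd z" for z :: nat
    using that by presburger
  have "fps_nth (norm_series ?S 9 (\<lambda>(a, z). a\<^sup>2 + 152 * z\<^sup>2)) (5 * n + 4)
      = (if n mod 5 = 1 then fps_nth (norm_series ?S 9 (\<lambda>(a, z). a\<^sup>2 + 152 * z\<^sup>2)) (n div 5) else 0)"
    by (rule norm_series_5[where sc = "\<lambda>(a, z). (5 * a, 5 * z)"])
      (use pair three in \<open>auto simp: inj_def power_mult_distrib coprime_6_iff\<close>)
  moreover have "fps_nth (norm_series {x. odd x} 9 (\<lambda>x. D * x\<^sup>2)) (5 * n + 4)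
      = (if n mod 5 = 1 then fps_nth (norm_series {x. odd x} 9 (\<lambda>x. D * x\<^sup>2)) (n div 5) else 0)"
    if "\<not> 5 dvd D" for D
    by (rule norm_series_5[where sc = "\<lambda>x. 5 * x"])
      (use odd that in \<open>auto simp: inj_def power_mult_distrib\<close>)
  moreover have "\<not> 5 dvd (9 :: nat)" "\<not> 5 dvd (57 :: nat)"
    by simp_all
  ultimately show ?thesis
    by (simp add: theta_combination_def)
qed

section \<open>The congruences for the coefficients\<close>

lemma cong_2_iff_bit: "[x = y] (mod 2) \<longleftrightarrow> (of_int x :: bit) = of_int y"
proof -
  have "(of_int x :: bit) = of_bool (odd x)" for x
  proof (cases "even x")
    case True
    then obtain z where "x = 2 * z"
      by (rule evenE)
    then show ?thesis
      by simp
  next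
    case False
    then obtain z where "x = 2 * z + 1"
      by (rule oddE)
    then show ?thesis
      by simp
  qed
  then show ?thesis
    by (simp add: cong_iff_dvd_diff)
qed

lemma b_regular_10:
  "[b_regular 19 (10 * n + 8) = (if n mod 5 = 1 then b_regular 19 (2 * (n div 5)) else 0)] (mod 2)"
proof -
  have "10 * n + 8 = 2 * (5 * n + 4)"
    by simp
  then show ?thesis
    unfolding cong_2_iff_bit by (cases "n mod 5 = 1") (simp_all only: b_regular_even_part theta_combination_5 of_int_0 if_True if_False simp_thms)
qed

text \<open>Each induction step sends \<open>m\<close> to \<open>25 * m + 9\<close>, by
  \<open>b_regular_10\<close> at \<open>5 * m + 1\<close>. The offset follows suit: if
  \<open>5 ^ (2 * d) = 24 * e + 1\<close>, the next quotient is \<open>25 * e + 1\<close>.\<close>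

lemma b_regular_iterate:
  "[b_regular 19 (2 * n)
    = b_regular 19 (2 * 5 ^ (2 * d) * n + 18 * ((5 ^ (2 * d) - 1) div 24))] (mod 2)"
proof (induction d)
  case (Suc d)
  define e where "e = (5 ^ (2 * d) - 1 :: nat) div 24"
  have "[5 ^ (2 * d) = 1 ^ d] (mod 24 :: nat)"
    unfolding power_mult by (rule cong_pow) (simp add: cong_def)
  then have "24 dvd (5 ^ (2 * d) - 1 :: nat)"
    by (intro cong_to_1_nat) simp
  then have e: "5 ^ (2 * d) = 24 * e + (1 :: nat)"
    unfolding e_def by simp
  have e': "(5 ^ (2 * Suc d) - 1) div 24 = 25 * e + (1 :: nat)"
  proof -
    have "5 ^ (2 * Suc d) = 25 * (5 ^ (2 * d) :: nat)"
      by simp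
    then have "5 ^ (2 * Suc d) - 1 = 24 * (25 * e + (1 :: nat))"
      unfolding e by simp
    then show ?thesis
      by (simp only: nonzero_mult_div_cancel_left)
  qed
  define m where "m = 5 ^ (2 * d) * n + 9 * e"
  have "[b_regular 19 (2 * n) = b_regular 19 (2 * m)] (mod 2)"
    using Suc unfolding m_def e_def by (simp add: algebra_simps)
  also have "[b_regular 19 (2 * m) = b_regular 19 (10 * (5 * m + 1) + 8)] (mod 2)"
  proof (rule cong_sym)
    have "(5 * m + 1) mod 5 = 1" "(5 * m + 1) div 5 = m"
      by presburger+
    then show "[b_regular 19 (10 * (5 * m + 1) + 8) = b_regular 19 (2 * m)] (mod 2)"
      using b_regular_10[of "5 * m + 1"] by (simp only: if_True simp_thms)
  qed
  also have "10 * (5 * m + 1) + 8 = 2 * 5 ^ (2 * Suc d) * n + 18 * ((5 ^ (2 * Suc d) - 1) div 24)"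
    unfolding e' m_def by simp
  finally show ?case .
qed simp

theorem theorem2p6:
  shows "fps_cong (Abs_fps (\<lambda>n. b_regular 19 (10 * n + 8)))
           (fps_X * fps_compose (Abs_fps (\<lambda>n. b_regular 19 (2 * n))) (fps_X ^ 5)) 2
    \<and> (\<forall>n k :: nat. \<not> [k = 1] (mod 5) \<longrightarrow>
         [b_regular 19 (50 * n + 10 * k + 8) = 0] (mod 2))
    \<and> (\<forall>d n :: nat. d \<ge> 1 \<longrightarrow>
         [b_regular 19 (2 * n)
            = b_regular 19 (2 * 5 ^ (2 * d) * n + 18 * ((5 ^ (2 * d) - 1) div 24))] (mod 2))
    \<and> (\<forall>d n k :: nat. d \<ge> 1 \<longrightarrow> \<not> [k = 1] (mod 5) \<longrightarrow>
         [b_regular 19 (2 * 5 ^ (2 * d) * (25 * n + 5 * k + 4)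
            + 18 * ((5 ^ (2 * d) - 1) div 24)) = 0] (mod 2))"
proof -
  have series: "[b_regular 19 (10 * n + 8)
      = fps_nth (fps_X * fps_compose (Abs_fps (\<lambda>n. b_regular 19 (2 * n))) (fps_X ^ 5)) n] (mod 2)" for n
  proof (cases n)
    case (Suc m)
    \<comment> \<open>The factor \<open>fps_X\<close> shifts the index by one, turning divisibility
      by 5 into the residue 1.\<close>
    have "n mod 5 = 1 \<longleftrightarrow> 5 dvd m"
      unfolding Suc by presburger
    moreover have "n div 5 = m div 5" if "5 dvd m"
      using that unfolding Suc by presburger
    ultimately show ?thesis
      using b_regular_10[of n] by (auto simp: Suc fps_nth_compose_X_power)
  qed (use b_regular_10[of 0] in simp)
  have zero: "[b_regular 19 (50 * n + 10 * k + 8) = 0] (mod 2)" if "\<not> [k = 1] (mod 5)" for n k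
  proof -
    have "(5 * n + k) mod 5 \<noteq> 1"
      using that by (simp add: cong_def)
    moreover have "50 * n + 10 * k + 8 = 10 * (5 * n + k) + 8"
      by simp
    ultimately show ?thesis
      using b_regular_10[of "5 * n + k"] by (simp only: if_False)
  qed
  have "[b_regular 19 (2 * 5 ^ (2 * d) * (25 * n + 5 * k + 4)
            + 18 * ((5 ^ (2 * d) - 1) div 24)) = 0] (mod 2)" if "\<not> [k = 1] (mod 5)" for d n k
  proof -
    \<comment> \<open>The index \<open>25 * n + 5 * k + 4\<close> is chosen so that its double falls
      under the vanishing claim; iteration then transports the zero.\<close>
    have eq: "2 * (25 * n + 5 * k + 4) = 50 * n + 10 * k + 8"
      by simp
    have "[b_regular 19 (2 * (25 * n + 5 * k + 4)) = 0] (mod 2)"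
      unfolding eq using that by (rule zero)
    with b_regular_iterate[of "25 * n + 5 * k + 4" d, THEN cong_sym] show ?thesis
      by (rule cong_trans)
  qed
  with series zero b_regular_iterate show ?thesis
    unfolding fps_cong_def fps_nth_Abs_fps by blast
qed

end
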